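(* Let $P\in\mathcal{P}$ be a property of torsion-free groups (i.e. every group satisfying $P$ is torsion-free) that is closed under amalgamation along infinite cyclic subgroups and under HNN extensions with associated subgroups that are infinite cyclic. Then there is a comeager set $\mathcal{X}_P\subset\mathcal{G}_P$ such that each $G\in\mathcal{X}_P$ has only one nontrivial conjugacy class (in particular, it is simple) and is verbally complete.
   Context: An enumerated group is a group whose underlying set is $\mathbf{N}=\{1,2,3,\ldots\}$. The set $\mathcal{G}$ of enumerated groups is identified, via (multiplication, inversion, identity), with a subset of $\mathbf{N}^{\mathbf{N}\times\mathbf{N}}\times\mathbf{N}^{\mathbf{N}}\times\mathbf{N}$ (product topology, $\mathbf{N}$ discrete) and given the subspace topology; it is a Polish space. For a property $P$ of groups, $\mathcal{G}_P\subset\mathcal{G}$ is the subspace of enumerated groups satisfying $P$. A subset of a space is comeager if it contains a countable intersection of dense open subsets of that space. $\mathcal{P}$ is the following set of properties of groups: amenability; having no subgroup isomorphic to the free group $\mathbf{F}_2$; left orderability (existence of a left-invariant total order); local indicability (every nontrivial finitely generated subgroup has an infinite cyclic quotient); biorderability (existence of a total order invariant under left and right translation); the unique product property (for all nonempty finite subsets $X,Y$ there is an element that can be written as $xy$ with $x\in X,y\in Y$ in exactly one way); torsion-freeness; soficity; not satisfying a law (for every nontrivial freely reduced word $w$ there is a tuple $\vec a$ in the group with $w(\vec a)\neq e$). For each $P\in\mathcal{P}$ the space $\mathcal{G}_P$ is Polish. A group $G$ is verbally complete if for every $n\in\mathbf{N}$, every nontrivial freely reduced word $W(x_1,\ldots,x_n)$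 in the letters $x_1^{\pm1},\ldots,x_n^{\pm1}$ and every $f\in G$, there are $g_1,\ldots,g_n\in G$ with $W(g_1,\ldots,g_n)=f$. *)

theory Defs
  imports
    "HOL-Algebra.Generated_Groups"
    "HOL-Algebra.Elementary_Groups"
    "HOL-Algebra.Group_Action"
    "HOL-Combinatorics.Permutations"
    "HOL-Analysis.Function_Topology"
begin

section \<open>Words and presentations\<close>

text \<open>The letter \<open>(x, True)\<close> stands for \<open>x\<close> and \<open>(x, False)\<close> for its formal inverse.\<close>

type_synonym 'g word = "('g \<times> bool) list"

definition words :: "'g set \<Rightarrow> 'g word set" where
  "words X = lists (X \<times> UNIV)"

definition freely_reduced :: "'g word \<Rightarrow> bool" where
  "freely_reduced = successively (\<lambda>(x, b) (y, c). x = y \<longrightarrow> b = c)"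

definition word_eval :: "('a, 'r) monoid_scheme \<Rightarrow> ('g \<Rightarrow> 'a) \<Rightarrow> 'g word \<Rightarrow> 'a" where
  "word_eval G a w =
     foldr (\<lambda>(x, b) y. (if b then a x else inv\<^bsub>G\<^esub> (a x)) \<otimes>\<^bsub>G\<^esub> y) w \<one>\<^bsub>G\<^esub>"

inductive pres_eq :: "'g set \<Rightarrow> 'g word set \<Rightarrow> 'g word \<Rightarrow> 'g word \<Rightarrow> bool" for X R where
  refl: "w \<in> words X \<Longrightarrow> pres_eq X R w w"
| sym: "pres_eq X R v w \<Longrightarrow> pres_eq X R w v"
| trans: "pres_eq X R u v \<Longrightarrow> pres_eq X R v w \<Longrightarrow> pres_eq X R u w"
| cancel: "u \<in> words X \<Longrightarrow> v \<in> words X \<Longrightarrow> x \<in> X \<Longrightarrow>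
    pres_eq X R (u @ [(x, b), (x, \<not> b)] @ v) (u @ v)"
| relator: "u \<in> words X \<Longrightarrow> v \<in> words X \<Longrightarrow> r \<in> R \<inter> words X \<Longrightarrow>
    pres_eq X R (u @ r @ v) (u @ v)"

text \<open>The group presented by generators \<open>X\<close> and relators \<open>R\<close>.\<close>

definition presented_group :: "'g set \<Rightarrow> 'g word set \<Rightarrow> 'g word set monoid" where
  "presented_group X R =
     \<lparr>carrier = words X // {(u, v). pres_eq X R u v},
      monoid.mult = (\<lambda>C D. \<Union>u\<in>C. \<Union>v\<in>D. {w. pres_eq X R (u @ v) w}),
      one = {w. pres_eq X R [] w}\<rparr>"

definition free_group :: "'g set \<Rightarrow> 'g word set monoid" where
  "free_group X = presented_group X {}"

definition table_relators :: "('a, 'r) monoid_scheme \<Rightarrow> ('a \<Rightarrow> 'g) \<Rightarrow> 'g word set" where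
  "table_relators G f =
     {[(f x, True), (f y, True), (f (x \<otimes>\<^bsub>G\<^esub> y), False)] | x y. x \<in> carrier G \<and> y \<in> carrier G}"

text \<open>The free product of \<open>G\<close> and \<open>H\<close> amalgamated along \<open>\<phi>\<close>, where \<open>\<phi>\<close> is an isomorphism
  from the subgroup \<open>A\<close> of \<open>G\<close> to a subgroup of \<open>H\<close>.\<close>

definition amalgamated_product ::
  "('a, 'r) monoid_scheme \<Rightarrow> ('b, 's) monoid_scheme \<Rightarrow> 'a set \<Rightarrow> ('a \<Rightarrow> 'b) \<Rightarrow> ('a + 'b) word set monoid"
where
  "amalgamated_product G H A \<phi> =
     presented_group (carrier G <+> carrier H)
       (table_relators G Inl \<union> table_relators H Inr \<union>
        {[(Inl a, True), (Inr (\<phi> a), False)] | a. a \<in> A})"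

text \<open>The HNN extension with stable letter \<open>t = None\<close> and relations
  \<open>t a t\<^sup>-\<^sup>1 = \<phi> a\<close> for \<open>a \<in> A\<close>.\<close>

definition hnn_extension ::
  "('a, 'r) monoid_scheme \<Rightarrow> 'a set \<Rightarrow> ('a \<Rightarrow> 'a) \<Rightarrow> 'a option word set monoid" where
  "hnn_extension G A \<phi> =
     presented_group (insert None (Some ` carrier G))
       (table_relators G Some \<union>
        {[(None, True), (Some a, True), (None, False), (Some (\<phi> a), False)] | a. a \<in> A})"

section \<open>Properties of groups\<close>

definition amenable :: "('a, 'r) monoid_scheme \<Rightarrow> bool" where
  "amenable G \<longleftrightarrow> (\<exists>\<mu> :: 'a set \<Rightarrow> real.
     \<mu> (carrier G) = 1 \<and>
     (\<forall>A \<subseteq> carrier G. 0 \<le> \<mu> A) \<and>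
     (\<forall>A \<subseteq> carrier G. \<forall>B \<subseteq> carrier G. A \<inter> B = {} \<longrightarrow> \<mu> (A \<union> B) = \<mu> A + \<mu> B) \<and>
     (\<forall>g \<in> carrier G. \<forall>A \<subseteq> carrier G. \<mu> (g <#\<^bsub>G\<^esub> A) = \<mu> A))"

definition no_F2_subgroup :: "('a, 'r) monoid_scheme \<Rightarrow> bool" where
  "no_F2_subgroup G \<longleftrightarrow>
     \<not> (\<exists>H. subgroup H G \<and> G\<lparr>carrier := H\<rparr> \<cong> free_group (UNIV :: bool set))"

definition left_orderable :: "('a, 'r) monoid_scheme \<Rightarrow> bool" where
  "left_orderable G \<longleftrightarrow> (\<exists>r. linear_order_on (carrier G) r \<and>
     (\<forall>(x, y) \<in> r. \<forall>g \<in> carrier G. (g \<otimes>\<^bsub>G\<^esub> x, g \<otimes>\<^bsub>G\<^esub> y) \<in> r))"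

definition locally_indicable :: "('a, 'r) monoid_scheme \<Rightarrow> bool" where
  "locally_indicable G \<longleftrightarrow>
     (\<forall>S H. finite S \<and> S \<subseteq> carrier G \<and> H = generate G S \<and> H \<noteq> {\<one>\<^bsub>G\<^esub>} \<longrightarrow>
        (\<exists>N. N \<lhd> G\<lparr>carrier := H\<rparr> \<and> (G\<lparr>carrier := H\<rparr> Mod N) \<cong> integer_group))"

definition biorderable :: "('a, 'r) monoid_scheme \<Rightarrow> bool" where
  "biorderable G \<longleftrightarrow> (\<exists>r. linear_order_on (carrier G) r \<and>
     (\<forall>(x, y) \<in> r. \<forall>g \<in> carrier G.
        (g \<otimes>\<^bsub>G\<^esub> x, g \<otimes>\<^bsub>G\<^esub> y) \<in> r \<and> (x \<otimes>\<^bsub>G\<^esub> g, y \<otimes>\<^bsub>G\<^esub> g) \<in> r))"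

definition unique_product_property :: "('a, 'r) monoid_scheme \<Rightarrow> bool" where
  "unique_product_property G \<longleftrightarrow>
     (\<forall>X Y. finite X \<and> finite Y \<and> X \<noteq> {} \<and> Y \<noteq> {} \<and> X \<subseteq> carrier G \<and> Y \<subseteq> carrier G \<longrightarrow>
        (\<exists>z. \<exists>!p. p \<in> X \<times> Y \<and> fst p \<otimes>\<^bsub>G\<^esub> snd p = z))"

definition torsion_free :: "('a, 'r) monoid_scheme \<Rightarrow> bool" where
  "torsion_free G \<longleftrightarrow>
     (\<forall>x \<in> carrier G. \<forall>n :: nat. 0 < n \<and> x [^]\<^bsub>G\<^esub> n = \<one>\<^bsub>G\<^esub> \<longrightarrow> x = \<one>\<^bsub>G\<^esub>)"

text \<open>Normalised Hamming distance on the symmetric group of \<open>{..<n}\<close>.\<close>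

definition hamming_dist :: "nat \<Rightarrow> (nat \<Rightarrow> nat) \<Rightarrow> (nat \<Rightarrow> nat) \<Rightarrow> real" where
  "hamming_dist n p q = real (card {i. i < n \<and> p i \<noteq> q i}) / real n"

definition sofic :: "('a, 'r) monoid_scheme \<Rightarrow> bool" where
  "sofic G \<longleftrightarrow>
     (\<forall>F. \<forall>\<epsilon> > 0. finite F \<and> F \<subseteq> carrier G \<longrightarrow>
        (\<exists>n > 0. \<exists>\<sigma>. (\<forall>g \<in> carrier G. \<sigma> g permutes {..<n}) \<and>
           (\<forall>g \<in> F. \<forall>h \<in> F. hamming_dist n (\<sigma> (g \<otimes>\<^bsub>G\<^esub> h)) (\<sigma> g \<circ> \<sigma> h) < \<epsilon>) \<and>
           (\<forall>g \<in> F - {\<one>\<^bsub>G\<^esub>}. hamming_dist n (\<sigma> g) id > 1 - \<epsilon>)))"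

definition no_law :: "('a, 'r) monoid_scheme \<Rightarrow> bool" where
  "no_law G \<longleftrightarrow>
     (\<forall>n :: nat. \<forall>w \<in> words {1..n}. w \<noteq> [] \<and> freely_reduced w \<longrightarrow>
        (\<exists>a \<in> {1..n} \<rightarrow> carrier G. word_eval G a w \<noteq> \<one>\<^bsub>G\<^esub>))"

text \<open>The set of properties is a datatype of names, so that one and the same property can be
  asserted of groups over different types (a group and an amalgamated product, say).\<close>

datatype group_property =
    Amenable
  | No_F2_Subgroup
  | Left_Orderable
  | Locally_Indicable
  | Biorderable
  | Unique_Product
  | Torsion_Free
  | Sofic
  | No_Law

fun has_property :: "('a, 'r) monoid_scheme \<Rightarrow> group_property \<Rightarrow> bool" where
  "has_property G Amenable = amenable G"
| "has_property G No_F2_Subgroup = no_F2_subgroup G"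
| "has_property G Left_Orderable = left_orderable G"
| "has_property G Locally_Indicable = locally_indicable G"
| "has_property G Biorderable = biorderable G"
| "has_property G Unique_Product = unique_product_property G"
| "has_property G Torsion_Free = torsion_free G"
| "has_property G Sofic = sofic G"
| "has_property G No_Law = no_law G"

text \<open>The three conditions below quantify over groups whose carrier is an arbitrary subset of
  \<open>nat\<close>, that is, over all countable groups up to isomorphism. As hypotheses they are implied by
  the corresponding conditions on groups of arbitrary cardinality.\<close>

definition property_of_torsion_free_groups :: "group_property \<Rightarrow> bool" where
  "property_of_torsion_free_groups P \<longleftrightarrow>
     (\<forall>G :: nat monoid. group G \<and> has_property G P \<longrightarrow> torsion_free G)"

definition infinite_cyclic_subgroup :: "'a set \<Rightarrow> ('a, 'r) monoid_scheme \<Rightarrow> bool" where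
  "infinite_cyclic_subgroup A G \<longleftrightarrow> subgroup A G \<and> G\<lparr>carrier := A\<rparr> \<cong> integer_group"

definition closed_under_cyclic_amalgamation :: "group_property \<Rightarrow> bool" where
  "closed_under_cyclic_amalgamation P \<longleftrightarrow>
     (\<forall>(G :: nat monoid) (H :: nat monoid) A B \<phi>.
        group G \<and> group H \<and> has_property G P \<and> has_property H P \<and>
        infinite_cyclic_subgroup A G \<and> infinite_cyclic_subgroup B H \<and>
        \<phi> \<in> iso (G\<lparr>carrier := A\<rparr>) (H\<lparr>carrier := B\<rparr>) \<longrightarrow>
        has_property (amalgamated_product G H A \<phi>) P)"

definition closed_under_cyclic_hnn :: "group_property \<Rightarrow> bool" where
  "closed_under_cyclic_hnn P \<longleftrightarrow>
     (\<forall>(G :: nat monoid) A B \<phi>.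
        group G \<and> has_property G P \<and>
        infinite_cyclic_subgroup A G \<and> infinite_cyclic_subgroup B G \<and>
        \<phi> \<in> iso (G\<lparr>carrier := A\<rparr>) (G\<lparr>carrier := B\<rparr>) \<longrightarrow>
        has_property (hnn_extension G A \<phi>) P)"

section \<open>The space of enumerated groups\<close>

text \<open>The type \<open>nat\<close> (which contains 0) serves as the countably infinite underlying set. Its
  topology is discrete, and function types carry the product topology.\<close>

type_synonym enumerated = "(nat \<times> nat \<Rightarrow> nat) \<times> (nat \<Rightarrow> nat) \<times> nat"

definition group_of :: "enumerated \<Rightarrow> nat monoid" where
  "group_of c = (case c of (m, i, e) \<Rightarrow>
     \<lparr>carrier = UNIV, monoid.mult = (\<lambda>x y. m (x, y)), one = e\<rparr>)"

definition enumerated_groups :: "enumerated set" where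
  "enumerated_groups =
     {c. group (group_of c) \<and> (\<forall>x. fst (snd c) x = inv\<^bsub>group_of c\<^esub> x)}"

definition enumerated_space :: "group_property \<Rightarrow> enumerated topology" where
  "enumerated_space P = top_of_set {c \<in> enumerated_groups. has_property (group_of c) P}"

definition comeager_in :: "'a topology \<Rightarrow> 'a set \<Rightarrow> bool" where
  "comeager_in T S \<longleftrightarrow> S \<subseteq> topspace T \<and>
     (\<exists>\<U>. countable \<U> \<and> (\<forall>U \<in> \<U>. openin T U \<and> T closure_of U = topspace T) \<and>
        topspace T \<inter> \<Inter>\<U> \<subseteq> S)"

section \<open>Properties of generic groups\<close>

definition conjugacy_classes :: "('a, 'r) monoid_scheme \<Rightarrow> 'a set set" where
  "conjugacy_classes G = orbits G (carrier G) (\<lambda>g x. g \<otimes>\<^bsub>G\<^esub> x \<otimes>\<^bsub>G\<^esub> inv\<^bsub>G\<^esub> g)"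

definition one_nontrivial_conjugacy_class :: "('a, 'r) monoid_scheme \<Rightarrow> bool" where
  "one_nontrivial_conjugacy_class G \<longleftrightarrow> (\<exists>!C. C \<in> conjugacy_classes G \<and> C \<noteq> {\<one>\<^bsub>G\<^esub>})"

text \<open>The library's \<open>simple_group\<close> is usable only for finite groups: it demands \<open>order G > 1\<close>,
  and \<open>order G\<close> is 0 when \<open>G\<close> is infinite.\<close>

definition is_simple :: "('a, 'r) monoid_scheme \<Rightarrow> bool" where
  "is_simple G \<longleftrightarrow> group G \<and> carrier G \<noteq> {\<one>\<^bsub>G\<^esub>} \<and>
     (\<forall>N. N \<lhd> G \<longrightarrow> N = carrier G \<or> N = {\<one>\<^bsub>G\<^esub>})"

definition verbally_complete :: "('a, 'r) monoid_scheme \<Rightarrow> bool" where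
  "verbally_complete G \<longleftrightarrow>
     (\<forall>n :: nat. \<forall>w \<in> words {1..n}. w \<noteq> [] \<and> freely_reduced w \<longrightarrow>
        (\<forall>f \<in> carrier G. \<exists>g \<in> {1..n} \<rightarrow> carrier G. word_eval G g w = f))"

end

theory Submission
  imports Defs "HOL-Algebra.Multiplicative_Group" "HOL-Algebra.Bij"
begin

text \<open>The properties in question are demanded one instance at a time: for each pair \<open>f, g\<close> of
  nontrivial elements, some \<open>h\<close> conjugates \<open>f\<close> to \<open>g\<close>; for each nontrivial reduced word \<open>w\<close>, some
  value of \<open>w\<close> is nontrivial. There are countably many such demands, and each of them is an open
  condition on an enumerated group. A group that meets all of them is simple with one nontrivial
  conjugacy class, and it is verbally complete: if \<open>f \<noteq> \<one>\<close> and \<open>w(a) \<noteq> \<one>\<close>, then some \<open>h\<close> conjugates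
  \<open>w(a)\<close> to \<open>f\<close>, so that \<open>w\<close> takes the value \<open>f\<close> at the tuple \<open>h a h\<^sup>-\<^sup>1\<close>.

  Each demand is also dense. A neighbourhood of an enumerated group \<open>G\<close> constrains only finitely
  many entries of its tables. If \<open>G\<close> embeds in a countable group \<open>K\<close> with the property \<open>P\<close>, then \<open>K\<close>
  can be enumerated so that the elements of \<open>G\<close> in question keep their names, and this copy of \<open>K\<close>
  lies in the neighbourhood (\<open>overgroup_realized_nearby\<close>). So it is enough to meet a demand in some
  overgroup \<open>K\<close> of \<open>G\<close> with \<open>P\<close>, and an HNN extension serves in both cases. Elements \<open>f, g \<noteq> \<one>\<close> have
  infinite order because groups with \<open>P\<close> are torsion-free, hence the HNN extension with
  \<open>t f t\<^sup>-\<^sup>1 = g\<close> has the property \<open>P\<close>, and in it \<open>f\<close> and \<open>g\<close> are conjugate. For a word \<open>w\<close> in \<open>n\<close> letters, take \<open>f \<noteq> \<one>\<close> and the HNN extension in which \<open>t\<close>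
  commutes with \<open>f\<close> to the power \<open>n + 1\<close>; there \<open>w\<close> has a nontrivial value at the
  conjugates of \<open>t\<close> by the \<open>n\<close> powers \<open>f\<close>, \<open>\<dots>\<close>, \<open>f\<^sup>n\<close> (\<open>conjugating_hnn_no_law\<close>).

  Two facts about these HNN extensions are needed: that \<open>G\<close> embeds in them, and that the value of \<open>w\<close>
  is nontrivial. Both are read off from an action by permutations instead of from normal forms. \<open>G\<close> acts
  on \<open>G \<times> \<nat>\<close> by left translation. An element \<open>f\<close> of infinite order has infinitely many orbits
  there, all of them infinite, so in suitable coordinates \<open>\<int> \<times> \<nat>\<close> it is the shift
  \<open>(k, m) \<mapsto> (k + 1, m)\<close> (\<open>shift_coordinates\<close>). Hence any two nontrivial elements act by conjugate
  permutations, and the faithful action of \<open>G\<close> extends to the HNN extension. Moreover, any family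
  of permutations \<open>\<pi>\<^sub>1, \<dots>, \<pi>\<^sub>n\<close> of \<open>\<nat>\<close> gives a permutation
  that applies \<open>\<pi>\<^sub>i\<close> to \<open>m\<close> when \<open>k\<close> is congruent to \<open>i\<close> modulo \<open>n + 1\<close>; it commutes with the shift
  by \<open>n + 1\<close>, so \<open>t\<close> may act by it, and then the \<open>i\<close>-th conjugate of \<open>t\<close> acts on the row \<open>k = 0\<close> as
  \<open>\<pi>\<^sub>i\<close>. It remains to choose the \<open>\<pi>\<^sub>i\<close> such that \<open>w\<close> moves a point
  (\<open>freely_reduced_word_moves_point\<close>).\<close>

section \<open>Evaluation of words\<close>

lemma word_eval_Nil [simp]: "word_eval G a [] = \<one>\<^bsub>G\<^esub>"
  by (simp add: word_eval_def)

lemma word_eval_Cons [simp]: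
  "word_eval G a ((x, b) # w) = (if b then a x else inv\<^bsub>G\<^esub> (a x)) \<otimes>\<^bsub>G\<^esub> word_eval G a w"
  by (simp add: word_eval_def)

lemma words_simps [simp]:
  "[] \<in> words X" "p # w \<in> words X \<longleftrightarrow> fst p \<in> X \<and> w \<in> words X"
  "u @ v \<in> words X \<longleftrightarrow> u \<in> words X \<and> v \<in> words X"
  by (cases p; auto simp: words_def)+

context group
begin

lemma word_eval_closed:
  "a \<in> X \<rightarrow> carrier G \<Longrightarrow> w \<in> words X \<Longrightarrow> word_eval G a w \<in> carrier G"
  by (induction w) (auto simp: Pi_iff)

lemma word_eval_append:
  "a \<in> X \<rightarrow> carrier G \<Longrightarrow> u \<in> words X \<Longrightarrow> v \<in> words X \<Longrightarrow>
   word_eval G a (u @ v) = word_eval G a u \<otimes> word_eval G a v"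
proof (induction u)
  case (Cons p u)
  then show ?case by (cases p) (simp add: m_assoc Pi_iff word_eval_closed[of a X])
qed (simp add: word_eval_closed)

lemma word_eval_const_one: "word_eval G (\<lambda>x. \<one>) w = \<one>"
  by (induction w) auto

end

lemma (in group_hom) hom_word_eval:
  "a \<in> X \<rightarrow> carrier G \<Longrightarrow> w \<in> words X \<Longrightarrow> h (word_eval G a w) = word_eval H (h \<circ> a) w"
proof (induction w)
  case (Cons p w)
  then show ?case by (cases p) (simp add: Pi_iff G.word_eval_closed[of a X])
qed auto

section \<open>Groups given by presentations\<close>

lemma pres_eq_words:
  "pres_eq X R u v \<Longrightarrow> u \<in> words X \<and> v \<in> words X"
  by (induction rule: pres_eq.induct) auto

text \<open>The two basic rewriting steps already carry an arbitrary context, so the congruence rules follow by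
  rule induction; they make concatenation well defined on classes.\<close>

lemma pres_eq_context:
  assumes "pres_eq X R u v" "p \<in> words X" "q \<in> words X"
  shows "pres_eq X R (p @ u @ q) (p @ v @ q)"
  using assms
proof (induction rule: pres_eq.induct)
  case (cancel u v x b)
  then show ?case
    using pres_eq.cancel[of "p @ u" X "v @ q" x R b] by simp
next
  case (relator u v r)
  then show ?case
    using pres_eq.relator[of "p @ u" X "v @ q" r R] by simp
qed (auto intro: pres_eq.intros)

lemma pres_eq_append:
  assumes "pres_eq X R u u'" "pres_eq X R v v'"
  shows "pres_eq X R (u @ v) (u' @ v')"
proof -
  have "pres_eq X R (u @ v) (u' @ v)"
    using pres_eq_context[OF assms(1), of "[]" v] pres_eq_words[OF assms(2)] by simp
  moreover have "pres_eq X R (u' @ v) (u' @ v')"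
    using pres_eq_context[OF assms(2), of u' "[]"] pres_eq_words[OF assms(1)] by simp
  ultimately show ?thesis by (rule pres_eq.trans)
qed

definition word_class :: "'g set \<Rightarrow> 'g word set \<Rightarrow> 'g word \<Rightarrow> 'g word set" where
  "word_class X R w = {v. pres_eq X R w v}"

lemma word_class_eq_iff:
  "u \<in> words X \<Longrightarrow> word_class X R u = word_class X R v \<longleftrightarrow> pres_eq X R u v"
  unfolding word_class_def by (blast intro: pres_eq.intros)

lemma carrier_presented_group: "carrier (presented_group X R) = word_class X R ` words X"
  by (auto simp: presented_group_def quotient_def word_class_def)

lemma word_class_in_carrier:
  "w \<in> words X \<Longrightarrow> word_class X R w \<in> carrier (presented_group X R)"
  by (simp add: carrier_presented_group)

lemma carrier_presented_groupE:
  assumes "C \<in> carrier (presented_group X R)"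
  obtains w where "w \<in> words X" "C = word_class X R w"
  using assms by (auto simp: carrier_presented_group)

lemma one_presented_group: "\<one>\<^bsub>presented_group X R\<^esub> = word_class X R []"
  by (simp add: presented_group_def word_class_def)

lemma mult_presented_group:
  assumes "u \<in> words X" "v \<in> words X"
  shows "word_class X R u \<otimes>\<^bsub>presented_group X R\<^esub> word_class X R v = word_class X R (u @ v)"
proof -
  have "{w. pres_eq X R (u' @ v') w} = word_class X R (u @ v)"
    if "u' \<in> word_class X R u" "v' \<in> word_class X R v" for u' v'
  proof -
    have "pres_eq X R (u @ v) (u' @ v')"
      using that by (intro pres_eq_append) (simp_all add: word_class_def)
    then show ?thesis
      unfolding word_class_def by (blast intro: pres_eq.sym pres_eq.trans)
  qed
  moreover have "u \<in> word_class X R u" "v \<in> word_class X R v"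
    using assms by (auto simp: word_class_def intro: pres_eq.refl)
  moreover have "(\<Union>u'\<in>A. \<Union>v'\<in>B. F u' v') = C"
    if "\<And>u' v'. u' \<in> A \<Longrightarrow> v' \<in> B \<Longrightarrow> F u' v' = C" "u \<in> A" "v \<in> B"
    for A B C and F :: "'a word \<Rightarrow> 'a word \<Rightarrow> 'a word set"
    using that by blast
  ultimately show ?thesis
    by (simp add: presented_group_def)
qed

lemma ex_inverse_word:
  assumes "w \<in> words X"
  shows "\<exists>w' \<in> words X. pres_eq X R (w' @ w) []"
  using assms
proof (induction w)
  case Nil
  then show ?case by (intro bexI[of _ "[]"]) (auto intro: pres_eq.refl)
next
  case (Cons p w)
  obtain x b where p: "p = (x, b)" by force
  obtain w' where w': "w' \<in> words X" "pres_eq X R (w' @ w) []"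
    using Cons by auto
  have "pres_eq X R (w' @ [(x, \<not> b), (x, \<not> \<not> b)] @ w) (w' @ w)"
    using Cons w' p by (intro pres_eq.cancel) auto
  then have "pres_eq X R ((w' @ [(x, \<not> b)]) @ p # w) []"
    using w'(2) p by (auto intro: pres_eq.trans)
  moreover have "w' @ [(x, \<not> b)] \<in> words X"
    using w'(1) Cons.prems p by simp
  ultimately show ?case by blast
qed

theorem group_presented_group: "group (presented_group X R)"
proof (rule groupI)
  fix C assume "C \<in> carrier (presented_group X R)"
  then obtain w where w: "w \<in> words X" "C = word_class X R w"
    by (rule carrier_presented_groupE)
  obtain w' where "w' \<in> words X" "pres_eq X R (w' @ w) []"
    using ex_inverse_word[OF w(1)] by blast
  then show "\<exists>D \<in> carrier (presented_group X R). D \<otimes>\<^bsub>presented_group X R\<^esub> C = \<one>\<^bsub>presented_group X R\<^esub>"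
    using w by (intro bexI[of _ "word_class X R w'"])
      (simp_all add: mult_presented_group one_presented_group word_class_eq_iff word_class_in_carrier)
qed (auto elim!: carrier_presented_groupE
    simp: word_class_in_carrier mult_presented_group one_presented_group)

lemma countable_presented_group:
  assumes "countable X"
  shows "countable (carrier (presented_group X R))"
proof -
  have "countable (words X)"
    unfolding words_def using assms by simp
  then show ?thesis by (simp add: carrier_presented_group)
qed

lemma inv_presented_group_letter:
  assumes "x \<in> X"
  shows "inv\<^bsub>presented_group X R\<^esub> (word_class X R [(x, True)]) = word_class X R [(x, False)]"
proof (rule group.inv_equality[OF group_presented_group])
  show "word_class X R [(x, False)] \<otimes>\<^bsub>presented_group X R\<^esub> word_class X R [(x, True)]
      = \<one>\<^bsub>presented_group X R\<^esub>"
    using pres_eq.cancel[of "[]" X "[]" x R False] assms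
    by (simp add: mult_presented_group one_presented_group word_class_eq_iff)
qed (use assms in \<open>simp_all add: word_class_in_carrier\<close>)

lemma relator_presented_group:
  assumes "r \<in> R" "r \<in> words X"
  shows "word_class X R r = \<one>\<^bsub>presented_group X R\<^esub>"
  using pres_eq.relator[of "[]" X "[]" r R] assms
  by (simp add: one_presented_group word_class_eq_iff)

text \<open>Von Dyck's theorem: both rewriting steps preserve the value of a word in a group where the
  relators have the value \<open>\<one>\<close>.\<close>

lemma (in group) presented_group_universal:
  assumes h: "h \<in> X \<rightarrow> carrier G"
    and rel: "\<And>r. r \<in> R \<Longrightarrow> r \<in> words X \<Longrightarrow> word_eval G h r = \<one>"
  obtains \<psi> where "\<psi> \<in> hom (presented_group X R) G"
    "\<And>w. w \<in> words X \<Longrightarrow> \<psi> (word_class X R w) = word_eval G h w"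
proof -
  have eq: "word_eval G h u = word_eval G h v" if "pres_eq X R u v" for u v
    using that
  proof (induction rule: pres_eq.induct)
    case (cancel u v x b)
    then have "h x \<in> carrier G" using h by auto
    with cancel have "word_eval G h ((x, b) # (x, \<not> b) # v) = word_eval G h v"
      by (cases b) (simp_all add: word_eval_closed[OF h] m_assoc[symmetric])
    with cancel show ?case
      by (simp add: word_eval_append[OF h] del: word_eval_Cons)
  next
    case (relator u v r)
    then show ?case
      by (auto simp: word_eval_append[OF h] word_eval_closed[OF h] rel)
  qed auto
  define \<psi> where "\<psi> C = the_elem (word_eval G h ` C)" for C
  have \<psi>: "\<psi> (word_class X R w) = word_eval G h w" if "w \<in> words X" for w
  proof -
    have "word_eval G h v = word_eval G h w" if "v \<in> word_class X R w" for v
      using eq[of w v] that by (simp add: word_class_def)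
    moreover have "w \<in> word_class X R w"
      using that by (simp add: word_class_def pres_eq.refl)
    ultimately have "word_eval G h ` word_class X R w = {word_eval G h w}"
      by blast
    then show ?thesis by (simp add: \<psi>_def)
  qed
  moreover have "\<psi> \<in> hom (presented_group X R) G"
    by (rule homI)
      (auto elim!: carrier_presented_groupE simp: mult_presented_group \<psi> word_eval_closed[OF h]
        word_eval_append[OF h])
  ultimately show thesis using that by blast
qed

text \<open>Every relator becomes an equation between the generators of the presented group: a class of words
  is the value of the word at the classes of the generators.\<close>

lemma word_eval_presented_group:
  "w \<in> words X \<Longrightarrow>
   word_eval (presented_group X R) (\<lambda>x. word_class X R [(x, True)]) w = word_class X R w"
proof (induction w)
  case (Cons p w)
  obtain x b where p: "p = (x, b)" by force
  have "(if b then word_class X R [(x, True)]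
      else inv\<^bsub>presented_group X R\<^esub> word_class X R [(x, True)]) = word_class X R [(x, b)]"
    using Cons.prems p by (simp add: inv_presented_group_letter)
  then show ?case
    using Cons p by (simp add: mult_presented_group)
qed (simp add: one_presented_group)

section \<open>HNN extensions\<close>

definition hnn_generators :: "('a, 'r) monoid_scheme \<Rightarrow> 'a option set" where
  "hnn_generators G = insert None (Some ` carrier G)"

definition hnn_relators ::
  "('a, 'r) monoid_scheme \<Rightarrow> 'a set \<Rightarrow> ('a \<Rightarrow> 'a) \<Rightarrow> 'a option word set" where
  "hnn_relators G A \<phi> = table_relators G Some \<union>
     {[(None, True), (Some a, True), (None, False), (Some (\<phi> a), False)] | a. a \<in> A}"

definition hnn_base ::
  "('a, 'r) monoid_scheme \<Rightarrow> 'a set \<Rightarrow> ('a \<Rightarrow> 'a) \<Rightarrow> 'a \<Rightarrow> 'a option word set" where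
  "hnn_base G A \<phi> x = word_class (hnn_generators G) (hnn_relators G A \<phi>) [(Some x, True)]"

definition stable_letter ::
  "('a, 'r) monoid_scheme \<Rightarrow> 'a set \<Rightarrow> ('a \<Rightarrow> 'a) \<Rightarrow> 'a option word set" where
  "stable_letter G A \<phi> = word_class (hnn_generators G) (hnn_relators G A \<phi>) [(None, True)]"

lemma hnn_extension_presentation:
  "hnn_extension G A \<phi> = presented_group (hnn_generators G) (hnn_relators G A \<phi>)"
  by (simp add: hnn_extension_def hnn_generators_def hnn_relators_def)

lemma group_hnn_extension: "group (hnn_extension G A \<phi>)"
  by (simp add: hnn_extension_presentation group_presented_group)

lemma countable_hnn_extension:
  "countable (carrier G) \<Longrightarrow> countable (carrier (hnn_extension G A \<phi>))"
  by (simp add: hnn_extension_presentation hnn_generators_def countable_presented_group)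

lemma hnn_base_closed: "x \<in> carrier G \<Longrightarrow> hnn_base G A \<phi> x \<in> carrier (hnn_extension G A \<phi>)"
  by (simp add: hnn_extension_presentation hnn_base_def word_class_in_carrier hnn_generators_def)

lemma stable_letter_closed: "stable_letter G A \<phi> \<in> carrier (hnn_extension G A \<phi>)"
  by (simp add: hnn_extension_presentation stable_letter_def word_class_in_carrier
      hnn_generators_def)

lemma hnn_relator:
  assumes "r \<in> hnn_relators G A \<phi>" "r \<in> words (hnn_generators G)"
  shows "word_eval (hnn_extension G A \<phi>)
    (\<lambda>x. case x of None \<Rightarrow> stable_letter G A \<phi> | Some y \<Rightarrow> hnn_base G A \<phi> y) r
    = \<one>\<^bsub>hnn_extension G A \<phi>\<^esub>"
proof -
  have "(\<lambda>x. case x of None \<Rightarrow> stable_letter G A \<phi> | Some y \<Rightarrow> hnn_base G A \<phi> y)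
    = (\<lambda>x. word_class (hnn_generators G) (hnn_relators G A \<phi>) [(x, True)])"
    by (auto simp: stable_letter_def hnn_base_def fun_eq_iff split: option.split)
  then show ?thesis
    using assms
    by (simp add: hnn_extension_presentation word_eval_presented_group relator_presented_group)
qed

lemma hnn_base_hom:
  assumes "group G"
  shows "hnn_base G A \<phi> \<in> hom G (hnn_extension G A \<phi>)"
proof (rule homI)
  interpret G: group G by fact
  interpret K: group "hnn_extension G A \<phi>" by (rule group_hnn_extension)
  note hnn_base_closed[of _ G A \<phi>, simp]
  show "hnn_base G A \<phi> (x \<otimes>\<^bsub>G\<^esub> y)
      = hnn_base G A \<phi> x \<otimes>\<^bsub>hnn_extension G A \<phi>\<^esub> hnn_base G A \<phi> y"
    if xy: "x \<in> carrier G" "y \<in> carrier G" for x y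
  proof -
    have "[(Some x, True), (Some y, True), (Some (x \<otimes>\<^bsub>G\<^esub> y), False)] \<in> hnn_relators G A \<phi>"
      using xy by (auto simp: hnn_relators_def table_relators_def)
    from hnn_relator[OF this] xy
    have "hnn_base G A \<phi> x \<otimes>\<^bsub>hnn_extension G A \<phi>\<^esub> hnn_base G A \<phi> y
        \<otimes>\<^bsub>hnn_extension G A \<phi>\<^esub> inv\<^bsub>hnn_extension G A \<phi>\<^esub> hnn_base G A \<phi> (x \<otimes>\<^bsub>G\<^esub> y)
        = \<one>\<^bsub>hnn_extension G A \<phi>\<^esub>"
      by (simp add: hnn_generators_def K.m_assoc)
    then show ?thesis
      using xy K.inv_solve_right'[of "\<one>\<^bsub>hnn_extension G A \<phi>\<^esub>"] by simp
  qed
qed (rule hnn_base_closed)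

lemma stable_letter_conjugates:
  assumes a: "a \<in> A" "a \<in> carrier G" "\<phi> a \<in> carrier G"
  defines "K \<equiv> hnn_extension G A \<phi>"
  shows "stable_letter G A \<phi> \<otimes>\<^bsub>K\<^esub> hnn_base G A \<phi> a \<otimes>\<^bsub>K\<^esub> inv\<^bsub>K\<^esub> stable_letter G A \<phi>
    = hnn_base G A \<phi> (\<phi> a)"
proof -
  interpret K: group K unfolding K_def by (rule group_hnn_extension)
  note closed = a hnn_base_closed[of _ G A \<phi>, folded K_def]
    stable_letter_closed[of G A \<phi>, folded K_def]
  have "[(None, True), (Some a, True), (None, False), (Some (\<phi> a), False)] \<in> hnn_relators G A \<phi>"
    using a by (auto simp: hnn_relators_def)
  from hnn_relator[OF this] closed
  have "stable_letter G A \<phi> \<otimes>\<^bsub>K\<^esub> hnn_base G A \<phi> a \<otimes>\<^bsub>K\<^esub> inv\<^bsub>K\<^esub> stable_letter G A \<phi>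
      \<otimes>\<^bsub>K\<^esub> inv\<^bsub>K\<^esub> hnn_base G A \<phi> (\<phi> a) = \<one>\<^bsub>K\<^esub>"
    by (simp add: hnn_generators_def K.m_assoc K_def[symmetric])
  moreover have "stable_letter G A \<phi> \<otimes>\<^bsub>K\<^esub> hnn_base G A \<phi> a \<otimes>\<^bsub>K\<^esub> inv\<^bsub>K\<^esub> stable_letter G A \<phi> \<in> carrier K"
    using closed by simp
  ultimately show ?thesis
    using closed K.inv_solve_right'[of "\<one>\<^bsub>K\<^esub>"] by simp
qed

lemma hnn_extension_universal:
  assumes "group G" "group Q"
    and h: "h \<in> hom G Q" and s: "s \<in> carrier Q"
    and A: "A \<subseteq> carrier G" "\<phi> ` A \<subseteq> carrier G"
    and rel: "\<And>a. a \<in> A \<Longrightarrow> s \<otimes>\<^bsub>Q\<^esub> h a \<otimes>\<^bsub>Q\<^esub> inv\<^bsub>Q\<^esub> s = h (\<phi> a)"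
  obtains \<psi> where "\<psi> \<in> hom (hnn_extension G A \<phi>) Q"
    "\<And>x. x \<in> carrier G \<Longrightarrow> \<psi> (hnn_base G A \<phi> x) = h x"
    "\<psi> (stable_letter G A \<phi>) = s"
proof -
  interpret Q: group Q by fact
  interpret h: group_hom G Q h
    using assms by (simp add: group_hom_def group_hom_axioms_def)
  define k where "k = case_option s h"
  have k: "k \<in> hnn_generators G \<rightarrow> carrier Q"
    using s by (auto simp: k_def hnn_generators_def)
  have "word_eval Q k r = \<one>\<^bsub>Q\<^esub>" if r: "r \<in> hnn_relators G A \<phi>" for r
  proof -
    consider (table) x y where "x \<in> carrier G" "y \<in> carrier G"
        "r = [(Some x, True), (Some y, True), (Some (x \<otimes>\<^bsub>G\<^esub> y), False)]"
      | (stable) a where "a \<in> A"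
        "r = [(None, True), (Some a, True), (None, False), (Some (\<phi> a), False)]"
      using r unfolding hnn_relators_def table_relators_def by blast
    then show ?thesis
    proof cases
      case table
      then show ?thesis
        by (simp add: k_def Q.m_assoc[symmetric])
    next
      case stable
      then have "a \<in> carrier G" "\<phi> a \<in> carrier G" using A by auto
      then show ?thesis
        using stable s rel[of a] by (simp add: k_def Q.m_assoc[symmetric])
    qed
  qed
  then obtain \<psi> where \<psi>: "\<psi> \<in> hom (hnn_extension G A \<phi>) Q"
    "\<And>w. w \<in> words (hnn_generators G) \<Longrightarrow>
       \<psi> (word_class (hnn_generators G) (hnn_relators G A \<phi>) w) = word_eval Q k w"
    using Q.presented_group_universal[OF k] unfolding hnn_extension_presentation by metis
  show thesis
  proof (rule that)
    show "\<psi> (hnn_base G A \<phi> x) = h x" if "x \<in> carrier G" for x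
    proof -
      have "[(Some x, True)] \<in> words (hnn_generators G)"
        using that by (simp add: hnn_generators_def)
      from \<psi>(2)[OF this] that show ?thesis by (simp add: hnn_base_def k_def)
    qed
    show "\<psi> (stable_letter G A \<phi>) = s"
      using s \<psi>(2)[of "[(None, True)]"]
      by (simp add: stable_letter_def hnn_generators_def k_def)
  qed (rule \<psi>(1))
qed

section \<open>Identifying two elements of infinite order up to conjugacy\<close>

lemma (in group) torsion_free_int_pow_inj:
  assumes "torsion_free G" "f \<in> carrier G" "f \<noteq> \<one>"
  shows "f [^] (k :: int) = f [^] (l :: int) \<longleftrightarrow> k = l"
proof -
  have "f [^] (ord f) = \<one>" using assms by simp
  then have "ord f = 0"
    using assms unfolding torsion_free_def by (metis gr0I)
  then show ?thesis using assms by (auto simp: int_pow_eq)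
qed

text \<open>For \<open>f\<close> of infinite order this is the homomorphism \<open>f\<^sup>k \<mapsto> g\<^sup>k\<close> on the powers of \<open>f\<close>.\<close>

definition power_map :: "('a, 'r) monoid_scheme \<Rightarrow> 'a \<Rightarrow> 'a \<Rightarrow> 'a \<Rightarrow> 'a" where
  "power_map G f g a = g [^]\<^bsub>G\<^esub> (THE k :: int. f [^]\<^bsub>G\<^esub> k = a)"

context group
begin

lemma power_map_pow:
  assumes "torsion_free G" "f \<in> carrier G" "f \<noteq> \<one>"
  shows "power_map G f g (f [^] (k :: int)) = g [^] k"
  by (simp add: power_map_def torsion_free_int_pow_inj[OF assms])

lemma int_pow_iso:
  assumes "torsion_free G" "f \<in> carrier G" "f \<noteq> \<one>"
  shows "(\<lambda>k :: int. f [^] k) \<in> iso integer_group (G\<lparr>carrier := generate G {f}\<rparr>)"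
  using assms(2)
  by (intro isoI homI)
    (auto simp: bij_betw_def inj_on_def torsion_free_int_pow_inj[OF assms] generate_pow int_pow_mult)

lemma infinite_cyclic_generate:
  assumes "torsion_free G" "f \<in> carrier G" "f \<noteq> \<one>"
  shows "infinite_cyclic_subgroup (generate G {f}) G"
proof -
  have "integer_group \<cong> G\<lparr>carrier := generate G {f}\<rparr>"
    using int_pow_iso[OF assms] by (auto simp: is_iso_def)
  then have "G\<lparr>carrier := generate G {f}\<rparr> \<cong> integer_group"
    using group.iso_sym group_integer_group by blast
  then show ?thesis
    using assms by (simp add: infinite_cyclic_subgroup_def generate_is_subgroup)
qed

lemma power_map_iso:
  assumes "torsion_free G" "f \<in> carrier G" "f \<noteq> \<one>" "g \<in> carrier G" "g \<noteq> \<one>"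
  shows "power_map G f g \<in> iso (G\<lparr>carrier := generate G {f}\<rparr>) (G\<lparr>carrier := generate G {g}\<rparr>)"
proof (rule isoI)
  note pm = power_map_pow[OF assms(1-3)]
  show "power_map G f g \<in> hom (G\<lparr>carrier := generate G {f}\<rparr>) (G\<lparr>carrier := generate G {g}\<rparr>)"
  proof (rule homI)
    fix x y
    assume "x \<in> carrier (G\<lparr>carrier := generate G {f}\<rparr>)" "y \<in> carrier (G\<lparr>carrier := generate G {f}\<rparr>)"
    then obtain k l :: int where "x = f [^] k" "y = f [^] l"
      using assms(2) by (auto simp: generate_pow)
    then show "power_map G f g (x \<otimes>\<^bsub>G\<lparr>carrier := generate G {f}\<rparr>\<^esub> y)
        = power_map G f g x \<otimes>\<^bsub>G\<lparr>carrier := generate G {g}\<rparr>\<^esub> power_map G f g y"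
      using assms by (simp add: pm int_pow_mult[symmetric])
  qed (use assms in \<open>auto simp: generate_pow pm\<close>)
  show "bij_betw (power_map G f g) (carrier (G\<lparr>carrier := generate G {f}\<rparr>))
      (carrier (G\<lparr>carrier := generate G {g}\<rparr>))"
    using assms
    by (auto simp: bij_betw_def inj_on_def generate_pow pm torsion_free_int_pow_inj image_iff)
      (metis pm)
qed

lemma conjugation_hom:
  assumes "s \<in> carrier G"
  shows "(\<lambda>x. s \<otimes> x \<otimes> inv s) \<in> hom G G"
proof (rule homI)
  have cancel: "inv s \<otimes> (s \<otimes> z) = z" if "z \<in> carrier G" for z
    using that assms by (simp flip: m_assoc)
  show "s \<otimes> (x \<otimes> y) \<otimes> inv s = s \<otimes> x \<otimes> inv s \<otimes> (s \<otimes> y \<otimes> inv s)"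
    if "x \<in> carrier G" "y \<in> carrier G" for x y
    using that assms by (simp add: m_assoc cancel)
qed (use assms in simp)

lemma conjugate_int_pow:
  assumes "s \<in> carrier G" "u \<in> carrier G" "s \<otimes> u \<otimes> inv s = v"
  shows "s \<otimes> (u [^] (k :: int)) \<otimes> inv s = v [^] k"
proof -
  have "(\<lambda>x. s \<otimes> x \<otimes> inv s) \<in> hom G G"
    using assms(1) by (rule conjugation_hom)
  from hom_int_pow[OF this assms(2) is_group is_group, of k] assms(3)
  show ?thesis by simp
qed

end

definition conjugating_hnn :: "('a, 'r) monoid_scheme \<Rightarrow> 'a \<Rightarrow> 'a \<Rightarrow> 'a option word set monoid" where
  "conjugating_hnn G f g = hnn_extension G (generate G {f}) (power_map G f g)"

section \<open>Permutations\<close>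

lemma carrier_BijGroup_UNIV [simp]: "p \<in> carrier (BijGroup UNIV) \<longleftrightarrow> bij p"
  by (simp add: BijGroup_def Bij_def)

lemma mult_BijGroup_UNIV [simp]: "bij p \<Longrightarrow> bij q \<Longrightarrow> p \<otimes>\<^bsub>BijGroup UNIV\<^esub> q = p \<circ> q"
  by (auto simp: BijGroup_def Bij_def compose_def)

lemma one_BijGroup_UNIV [simp]: "\<one>\<^bsub>BijGroup UNIV\<^esub> = id"
  by (auto simp: BijGroup_def)

lemma inv_BijGroup_UNIV [simp]: "bij p \<Longrightarrow> inv\<^bsub>BijGroup UNIV\<^esub> p = Hilbert_Choice.inv p"
  by (subst inv_BijGroup) (auto simp: Bij_def)

lemma bij_word_eval_BijGroup:
  assumes "\<And>x. x \<in> X \<Longrightarrow> bij (p x)" "w \<in> words X"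
  shows "bij (word_eval (BijGroup UNIV) p w)"
  using group.word_eval_closed[OF group_BijGroup, of p X UNIV w] assms by auto

lemma word_eval_BijGroup_Cons:
  assumes "\<And>x. x \<in> X \<Longrightarrow> bij (p x)" "x \<in> X" "w \<in> words X"
  shows "word_eval (BijGroup UNIV) p ((x, b) # w)
    = (if b then p x else Hilbert_Choice.inv (p x)) \<circ> word_eval (BijGroup UNIV) p w"
  using assms bij_word_eval_BijGroup[of X p w] by (simp add: bij_imp_bij_inv)

text \<open>This restricts an action to an invariant part: \<open>c\<close> embeds the points on which the \<open>q x\<close> act, and
  the \<open>p x\<close> act on its image as the \<open>q x\<close> do.\<close>

lemma word_eval_BijGroup_semiconj:
  assumes p: "\<And>x. x \<in> X \<Longrightarrow> bij (p x)" and q: "\<And>x. x \<in> X \<Longrightarrow> bij (q x)"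
    and c: "\<And>x m. x \<in> X \<Longrightarrow> p x (c m) = c (q x m)"
    and "w \<in> words X"
  shows "word_eval (BijGroup UNIV) p w (c m) = c (word_eval (BijGroup UNIV) q w m)"
  using \<open>w \<in> words X\<close>
proof (induction w)
  case (Cons l w)
  obtain x b where l: "l = (x, b)" by force
  have x: "x \<in> X" and w: "w \<in> words X" using Cons.prems l by auto
  have "Hilbert_Choice.inv (p x) (c k) = c (Hilbert_Choice.inv (q x) k)" for k
    using c[OF x, of "Hilbert_Choice.inv (q x) k"] p[OF x] q[OF x]
    by (metis bij_inv_eq_iff)
  then show ?case
    using Cons.IH[OF w] c[OF x] by (simp add: l word_eval_BijGroup_Cons[OF p x w] word_eval_BijGroup_Cons[OF q x w] del: word_eval_Cons)
qed simp

text \<open>The complements of a finite set and of its image are both countably infinite, so they can be matched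
  arbitrarily. This serves twice: to complete a finite piece of a permutation, and to enumerate a
  group with finitely many names prescribed.\<close>

lemma finite_injection_extends_to_bijection:
  assumes "finite F" "inj_on f F" "F \<subseteq> U" "f ` F \<subseteq> V"
    and "countable U" "infinite U" "countable V" "infinite V"
  obtains p where "bij_betw p U V" "\<And>x. x \<in> F \<Longrightarrow> p x = f x"
proof -
  have "bij_betw (to_nat_on (U - F)) (U - F) UNIV"
    using assms by (intro to_nat_on_infinite) auto
  moreover have "bij_betw (from_nat_into (V - f ` F)) UNIV (V - f ` F)"
    using assms by (intro bij_betw_from_nat_into) auto
  ultimately obtain q where "bij_betw q (U - F) (V - f ` F)"
    using bij_betw_trans by blast
  moreover have "bij_betw f F (f ` F)"
    using assms(2) by (simp add: bij_betw_def)
  ultimately have "bij_betw (\<lambda>x. if x \<in> F then f x else q x) (F \<union> (U - F)) (f ` F \<union> (V - f ` F))"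
    by (intro bij_betw_disjoint_Un) auto
  moreover have "F \<union> (U - F) = U" "f ` F \<union> (V - f ` F) = V" using assms by auto
  ultimately show thesis
    using that[of "\<lambda>x. if x \<in> F then f x else q x"] by simp
qed

lemma finite_partial_injection_extends_to_permutation:
  fixes S :: "(nat \<times> nat) set"
  assumes "finite S" "single_valued S" "single_valued (S\<inverse>)"
  obtains p where "bij p" "\<And>i j. (i, j) \<in> S \<Longrightarrow> p i = j"
proof -
  define f where "f i = (THE j. (i, j) \<in> S)" for i
  have f: "f i = j" if "(i, j) \<in> S" for i j
    using that assms(2) unfolding f_def by (auto dest: single_valuedD)
  have "inj_on f (Domain S)"
    using single_valuedD[OF assms(3)] by (fastforce simp: inj_on_def f)
  then obtain p where "bij_betw p UNIV UNIV" "\<And>i. i \<in> Domain S \<Longrightarrow> p i = f i"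
    using finite_injection_extends_to_bijection[of "Domain S" f UNIV UNIV] assms(1)
    by (auto simp: finite_Domain)
  then show thesis using that f by (metis DomainI)
qed

text \<open>Lay the word along the path \<open>0, 1, \<dots>, length w\<close> so that its \<open>i\<close>-th letter takes \<open>i + 1\<close> to \<open>i\<close>.
  Every letter then prescribes a finite piece of a permutation. Two prescriptions for the same letter
  \<open>x\<close> can clash only at a point where \<open>x\<close> and its inverse are adjacent in \<open>w\<close>, which free reduction
  excludes.\<close>

lemma freely_reduced_word_moves_point:
  assumes "freely_reduced w"
  obtains \<pi> :: "'g \<Rightarrow> nat \<Rightarrow> nat"
  where "\<And>x. bij (\<pi> x)" "word_eval (BijGroup UNIV) \<pi> w (length w) = 0"
proof -
  define S where "S x = {(a, b). (\<exists>i < length w. w ! i = (x, True) \<and> a = Suc i \<and> b = i) \<or>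
    (\<exists>i < length w. w ! i = (x, False) \<and> a = i \<and> b = Suc i)}" for x
  have red: False if "Suc i < length w" "w ! i = (x, b)" "w ! Suc i = (x, \<not> b)" for i x b
    using assms that unfolding freely_reduced_def successively_conv_nth
    by (auto dest: spec[of _ i])
  have "\<exists>p. bij p \<and> (\<forall>i j. (i, j) \<in> S x \<longrightarrow> p i = j)" for x
  proof -
    have "S x \<subseteq> {..length w} \<times> {..length w}" by (auto simp: S_def)
    then have "finite (S x)" by (rule finite_subset) simp
    moreover have "single_valued (S x)"
      by (rule single_valuedI) (auto simp: S_def dest: red)
    moreover have "single_valued ((S x)\<inverse>)"
      by (rule single_valuedI) (auto simp: S_def dest: red)
    ultimately show ?thesis
      using finite_partial_injection_extends_to_permutation[of "S x"] by metis
  qed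
  then obtain \<pi> where \<pi>: "\<And>x. bij (\<pi> x)" "\<And>x i j. (i, j) \<in> S x \<Longrightarrow> \<pi> x i = j"
    by metis
  \<comment> \<open>Read from right to left, the word walks down the path from its far end.\<close>
  have "word_eval (BijGroup UNIV) \<pi> (drop j w) (length w) = j" if "j \<le> length w" for j
    using that
  proof (induction j rule: inc_induct)
    case (step j)
    obtain x b where xb: "w ! j = (x, b)" by force
    have w: "drop (Suc j) w \<in> words UNIV" by (simp add: words_def)
    have "(if b then \<pi> x else Hilbert_Choice.inv (\<pi> x)) (Suc j) = j"
    proof (cases b)
      case True
      then show ?thesis using \<pi>(2)[of "Suc j" j x] step xb by (simp add: S_def)
    next
      case False
      then have "\<pi> x j = Suc j" using \<pi>(2)[of j "Suc j" x] step xb by (simp add: S_def)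
      then have "j = Hilbert_Choice.inv (\<pi> x) (Suc j)"
        by (simp add: bij_inv_eq_iff \<pi>(1))
      then show ?thesis using False by simp
    qed
    then show ?case
      using step word_eval_BijGroup_Cons[of UNIV \<pi> x "drop (Suc j) w" b] \<pi>(1) w
      by (simp add: Cons_nth_drop_Suc[symmetric] xb del: word_eval_Cons)
  qed simp
  from this[of 0] show thesis using that[of \<pi>] \<pi>(1) by simp
qed

section \<open>Permutation actions of cyclic HNN extensions\<close>

text \<open>The second factor provides infinitely many copies of the regular action, so that even an element
  whose powers have finite index in the group has infinitely many orbits.\<close>

definition left_translation :: "('a, 'r) monoid_scheme \<Rightarrow> 'a \<Rightarrow> 'a \<times> nat \<Rightarrow> 'a \<times> nat" where
  "left_translation G x = (\<lambda>(y, n). (x \<otimes>\<^bsub>G\<^esub> y, n))"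

locale enumerable_torsion_free_group = group G
  for G :: "('a::countable) monoid" (structure) +
  assumes carrier_UNIV [simp]: "carrier G = UNIV"
    and torsion_free: "torsion_free G"
begin

abbreviation \<rho> :: "'a \<Rightarrow> 'a \<times> nat \<Rightarrow> 'a \<times> nat" where "\<rho> \<equiv> left_translation G"

lemma left_translation_mult: "\<rho> (x \<otimes> y) = \<rho> x \<circ> \<rho> y"
  by (auto simp: left_translation_def m_assoc)

lemma left_translation_one: "\<rho> \<one> = id"
  by (auto simp: left_translation_def)

lemma bij_left_translation: "bij (\<rho> x)"
proof (rule o_bij)
  show "\<rho> (inv x) \<circ> \<rho> x = id" "\<rho> x \<circ> \<rho> (inv x) = id"
    by (simp_all add: left_translation_one flip: left_translation_mult)
qed

lemma left_translation_hom: "\<rho> \<in> hom G (BijGroup UNIV)"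
  by (rule homI) (simp_all add: bij_left_translation left_translation_mult)

lemma left_translation_inj: "\<rho> x = \<rho> y \<Longrightarrow> x = y"
  by (auto simp: left_translation_def dest!: fun_cong[of _ _ "(\<one>, 0)"])

text \<open>Translation by \<open>f\<close> is free, and all its orbits are infinite. With \<open>T\<close> a set of representatives of
  the right cosets of the powers of \<open>f\<close>, the orbits correspond to the countably infinite set \<open>T \<times> \<nat>\<close>,
  and the position in an orbit is the exponent of \<open>f\<close>.\<close>

lemma shift_coordinates:
  assumes f: "f \<noteq> \<one>"
  obtains c :: "int \<times> nat \<Rightarrow> 'a \<times> nat"
  where "bij c" "\<And>j k m. \<rho> (f [^] (j :: int)) (c (k, m)) = c (j + k, m)"
proof -
  define C where "C x = {f [^] (k :: int) \<otimes> x | k. True}" for x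
  \<comment> \<open>A choice that depends on the coset only.\<close>
  define rep where "rep x = (SOME y. y \<in> C x)" for x
  note pow_inj = torsion_free_int_pow_inj[OF torsion_free _ f, simplified]
  have C_pow: "C (f [^] (k :: int) \<otimes> x) = C x" for k x
  proof -
    have "f [^] (j :: int) \<otimes> (f [^] k \<otimes> x) = f [^] (j + k) \<otimes> x" for j
      by (simp add: int_pow_mult m_assoc)
    moreover have "f [^] (j :: int) \<otimes> x = f [^] ((j - k) + k) \<otimes> x" for j
      by simp
    ultimately show ?thesis unfolding C_def by (metis (no_types, lifting))
  qed
  have "f [^] (0 :: int) \<otimes> x \<in> C x" for x unfolding C_def by blast
  then have rep: "rep x \<in> C x" for x
    unfolding rep_def by (metis someI)
  then have rep_pow: "\<exists>k :: int. x = f [^] k \<otimes> rep x" for x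
  proof -
    obtain k :: int where "rep x = f [^] k \<otimes> x" using rep[of x] by (auto simp: C_def)
    then have "f [^] (- k) \<otimes> rep x = x"
      by (simp add: m_assoc[symmetric] int_pow_mult[symmetric])
    then show ?thesis by metis
  qed
  have rep_cong: "rep x = rep y" if "C x = C y" for x y
    using that by (simp add: rep_def)
  have C_rep: "C (rep x) = C x" for x
    using rep_pow[of x] C_pow by metis
  define T where "T = range rep"
  have T_unique: "s = t \<and> k = l"
    if "f [^] (k :: int) \<otimes> s = f [^] (l :: int) \<otimes> t" "s \<in> T" "t \<in> T" for k l s t
  proof -
    have "C s = C t" using C_pow that(1) by metis
    then have "s = t" using that rep_cong C_rep unfolding T_def by (metis imageE)
    with that show ?thesis by (simp add: pow_inj)
  qed
  have "bij_betw (from_nat_into (T \<times> (UNIV :: nat set))) UNIV (T \<times> UNIV)"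
    by (intro bij_betw_from_nat_into) (auto simp: T_def finite_cartesian_product_iff)
  then obtain e where e: "bij_betw e (UNIV :: nat set) (T \<times> (UNIV :: nat set))" by blast
  define c where "c = (\<lambda>(k :: int, m). (f [^] k \<otimes> fst (e m), snd (e m)))"
  have e_T: "fst (e m) \<in> T" for m
    using bij_betwE[OF e] by (auto simp: mem_Times_iff)
  have "inj c"
  proof (rule injI, clarify)
    fix k l :: int and m n :: nat
    assume "c (k, m) = c (l, n)"
    then have *: "f [^] k \<otimes> fst (e m) = f [^] l \<otimes> fst (e n)" "snd (e m) = snd (e n)"
      by (auto simp: c_def)
    from T_unique[OF *(1) e_T e_T] *(2) have "k = l" "e m = e n" by (auto simp: prod_eq_iff)
    then show "k = l \<and> m = n" using e by (auto simp: bij_betw_def inj_on_def)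
  qed
  moreover have "surj c"
    unfolding surj_def
  proof
    show "\<exists>z. y = c z" for y
    proof -
      obtain k :: int where k: "fst y = f [^] k \<otimes> rep (fst y)" using rep_pow by blast
      have "(rep (fst y), snd y) \<in> range e" using e by (auto simp: bij_betw_def T_def)
      then obtain m where "e m = (rep (fst y), snd y)" by auto
      with k have "y = c (k, m)" by (simp add: c_def prod_eq_iff)
      then show ?thesis by blast
    qed
  qed
  moreover have "\<rho> (f [^] (j :: int)) (c (k, m)) = c (j + k, m)" for j k m
    by (simp add: left_translation_def c_def int_pow_mult m_assoc)
  ultimately show thesis using that by (simp add: bij_def)
qed

text \<open>It suffices to check the relation of the HNN extension for the generator \<open>f\<close> of the associated
  subgroup, since conjugation by \<open>\<tau>\<close> is a homomorphism.\<close>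

lemma conjugating_hnn_permutations:
  assumes "f \<noteq> \<one>" "g \<noteq> \<one>" "bij \<tau>" "\<tau> \<circ> \<rho> f = \<rho> g \<circ> \<tau>"
  obtains \<psi> where "\<psi> \<in> hom (conjugating_hnn G f g) (BijGroup UNIV)"
    "\<And>x. \<psi> (hnn_base G (generate G {f}) (power_map G f g) x) = \<rho> x"
    "\<psi> (stable_letter G (generate G {f}) (power_map G f g)) = \<tau>"
proof -
  interpret Q: group "BijGroup (UNIV :: ('a \<times> nat) set)" by (rule group_BijGroup)
  have "\<tau> \<otimes>\<^bsub>BijGroup UNIV\<^esub> \<rho> f \<otimes>\<^bsub>BijGroup UNIV\<^esub> inv\<^bsub>BijGroup UNIV\<^esub> \<tau> = \<rho> g"
    using assms surj_iff[THEN iffD1, OF bij_is_surj[OF assms(3)]]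
    by (simp add: bij_left_translation bij_comp bij_imp_bij_inv comp_assoc)
  then have rel: "\<tau> \<otimes>\<^bsub>BijGroup UNIV\<^esub> \<rho> (f [^] k) \<otimes>\<^bsub>BijGroup UNIV\<^esub> inv\<^bsub>BijGroup UNIV\<^esub> \<tau> = \<rho> (g [^] k)"
    for k :: int
    using Q.conjugate_int_pow[of \<tau> "\<rho> f"] assms(3)
      hom_int_pow[OF left_translation_hom _ is_group Q.is_group]
    by (simp add: bij_left_translation)
  obtain \<psi> where "\<psi> \<in> hom (conjugating_hnn G f g) (BijGroup UNIV)"
    "\<And>x. x \<in> carrier G \<Longrightarrow> \<psi> (hnn_base G (generate G {f}) (power_map G f g) x) = \<rho> x"
    "\<psi> (stable_letter G (generate G {f}) (power_map G f g)) = \<tau>"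
    unfolding conjugating_hnn_def
  proof (rule hnn_extension_universal[OF is_group Q.is_group left_translation_hom,
        of \<tau> "generate G {f}" "power_map G f g"])
    fix a assume "a \<in> generate G {f}"
    then obtain k :: int where "a = f [^] k" by (auto simp: generate_pow)
    then show "\<tau> \<otimes>\<^bsub>BijGroup UNIV\<^esub> \<rho> a \<otimes>\<^bsub>BijGroup UNIV\<^esub> inv\<^bsub>BijGroup UNIV\<^esub> \<tau>
        = \<rho> (power_map G f g a)"
      using rel assms(1) by (simp add: power_map_pow[OF torsion_free])
  qed (use assms(3) in auto)
  then show thesis using that by simp
qed

text \<open>Both \<open>f\<close> and \<open>g\<close> are the shift in their respective coordinates \<open>c\<close> and \<open>d\<close>, so the change of
  coordinates conjugates one to the other, and the faithful action of the group factors through the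
  HNN extension.\<close>

lemma conjugating_hnn_base_inj:
  assumes "f \<noteq> \<one>" "g \<noteq> \<one>"
  shows "inj (hnn_base G (generate G {f}) (power_map G f g))"
proof -
  obtain c :: "int \<times> nat \<Rightarrow> 'a \<times> nat"
    where c: "bij c" "\<And>j k m. \<rho> (f [^] (j :: int)) (c (k, m)) = c (j + k, m)"
    by (rule shift_coordinates[OF assms(1)]) blast
  obtain d :: "int \<times> nat \<Rightarrow> 'a \<times> nat"
    where d: "bij d" "\<And>j k m. \<rho> (g [^] (j :: int)) (d (k, m)) = d (j + k, m)"
    by (rule shift_coordinates[OF assms(2)]) blast
  \<comment> \<open>The coordinates of \<open>f\<close> are replaced by those of \<open>g\<close>.\<close>
  define \<tau> where "\<tau> = d \<circ> Hilbert_Choice.inv c"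
  have \<tau>_c: "\<tau> (c z) = d z" for z using c(1) by (simp add: \<tau>_def bij_is_inj)
  have "bij \<tau>" unfolding \<tau>_def using c(1) d(1) by (simp add: bij_comp bij_imp_bij_inv)
  moreover have "\<tau> \<circ> \<rho> f = \<rho> g \<circ> \<tau>"
  proof
    fix y
    obtain k m where "y = c (k, m)" using c(1) by (metis bij_pointE surj_pair)
    then show "(\<tau> \<circ> \<rho> f) y = (\<rho> g \<circ> \<tau>) y"
      using c(2)[of 1] d(2)[of 1] by (simp add: \<tau>_c)
  qed
  ultimately obtain \<psi> where
    "\<And>x. \<psi> (hnn_base G (generate G {f}) (power_map G f g) x) = \<rho> x"
    using conjugating_hnn_permutations[OF assms] by metis
  then show ?thesis by (metis injI left_translation_inj)
qed

text \<open>The modulus is \<open>n + 1\<close> because \<open>\<sigma>\<close> then acts on the rows \<open>1, \<dots>, n\<close> by independent permutations,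
  while it commutes with the shift by \<open>n + 1\<close>, which is the action of \<open>g\<close>. Conjugating by \<open>f\<^sup>i\<close> brings row \<open>i\<close> to row \<open>0\<close>, so the
  conjugates of the stable letter act on row \<open>0\<close> by arbitrary permutations \<open>\<pi> 1, \<dots>, \<pi> n\<close>.\<close>

lemma conjugating_hnn_no_law:
  assumes f: "f \<noteq> \<one>" and w: "w \<in> words {1..n::nat}" "w \<noteq> []" "freely_reduced w"
  defines "g \<equiv> f [^] (int n + 1)"
  defines "K \<equiv> conjugating_hnn G g g"
  shows "\<exists>a \<in> {1..n} \<rightarrow> carrier K. word_eval K a w \<noteq> \<one>\<^bsub>K\<^esub>"
proof -
  let ?\<iota> = "hnn_base G (generate G {g}) (power_map G g g)"
  let ?t = "stable_letter G (generate G {g}) (power_map G g g)"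
  let ?S = "BijGroup (UNIV :: ('a \<times> nat) set)"
  interpret K: group K unfolding K_def conjugating_hnn_def by (rule group_hnn_extension)
  have closed: "?\<iota> x \<in> carrier K" "?t \<in> carrier K" for x
    by (simp_all add: K_def conjugating_hnn_def hnn_base_closed stable_letter_closed)
  have g: "g \<noteq> \<one>"
    using torsion_free_int_pow_inj[OF torsion_free _ f, of "int n + 1" 0] by (simp add: g_def)
  obtain \<pi> :: "nat \<Rightarrow> nat \<Rightarrow> nat"
    where \<pi>: "\<And>i. bij (\<pi> i)" "word_eval (BijGroup UNIV) \<pi> w (length w) = 0"
    by (rule freely_reduced_word_moves_point[OF w(3)]) blast
  obtain c :: "int \<times> nat \<Rightarrow> 'a \<times> nat"
    where c: "bij c" "\<And>j k m. \<rho> (f [^] (j :: int)) (c (k, m)) = c (j + k, m)"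
    by (rule shift_coordinates[OF f]) blast
  define \<sigma> where "\<sigma> = (\<lambda>(k :: int, m). (k, \<pi> (nat (k mod (int n + 1))) m))"
  define \<tau> where "\<tau> = c \<circ> \<sigma> \<circ> Hilbert_Choice.inv c"
  have "bij \<sigma>"
  proof (rule o_bij)
    show "(\<lambda>(k, m). (k, Hilbert_Choice.inv (\<pi> (nat (k mod (int n + 1)))) m)) \<circ> \<sigma> = id"
      "\<sigma> \<circ> (\<lambda>(k, m). (k, Hilbert_Choice.inv (\<pi> (nat (k mod (int n + 1)))) m)) = id"
      using \<pi>(1) by (auto simp: \<sigma>_def bij_is_inj bij_is_surj surj_f_inv_f)
  qed
  then have bij_\<tau>: "bij \<tau>" unfolding \<tau>_def using c(1) by (simp add: bij_comp bij_imp_bij_inv)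
  have \<tau>_c: "\<tau> (c (k, m)) = c (k, \<pi> (nat (k mod (int n + 1))) m)" for k m
    using c(1) by (simp add: \<tau>_def \<sigma>_def bij_is_inj)
  have "\<tau> \<circ> \<rho> g = \<rho> g \<circ> \<tau>"
  proof
    fix y
    obtain k m where y: "y = c (k, m)" using c(1) by (metis bij_pointE surj_pair)
    have "(int n + 1 + k) mod (int n + 1) = k mod (int n + 1)" by simp
    then show "(\<tau> \<circ> \<rho> g) y = (\<rho> g \<circ> \<tau>) y"
      by (simp only: y g_def c(2) \<tau>_c o_apply)
  qed
  from conjugating_hnn_permutations[OF g g bij_\<tau> this]
  obtain \<psi> where \<psi>: "\<psi> \<in> hom K ?S" "\<And>x. \<psi> (?\<iota> x) = \<rho> x" "\<psi> ?t = \<tau>"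
    unfolding K_def by metis
  interpret \<psi>: group_hom K ?S \<psi>
    using \<psi>(1) K.is_group by (simp add: group_hom_def group_hom_axioms_def group_BijGroup)
  define a where "a i = ?\<iota> (f [^] (- int i)) \<otimes>\<^bsub>K\<^esub> ?t \<otimes>\<^bsub>K\<^esub> ?\<iota> (f [^] int i)" for i
  have a: "a \<in> {1..n} \<rightarrow> carrier K" using closed by (auto simp: a_def)
  have \<psi>_a: "\<psi> (a i) = \<rho> (f [^] (- int i)) \<circ> \<tau> \<circ> \<rho> (f [^] int i)" for i
    using closed bij_left_translation bij_\<tau> by (simp add: a_def \<psi>(2,3) bij_comp)
  have "word_eval ?S (\<psi> \<circ> a) w (c (0, length w)) = c (0, word_eval (BijGroup UNIV) \<pi> w (length w))"
  proof (rule word_eval_BijGroup_semiconj[of "{1..n}" _ \<pi> "\<lambda>m. c (0, m)"])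
    show "bij ((\<psi> \<circ> a) i)" for i
      using bij_left_translation bij_\<tau> by (simp add: \<psi>_a bij_comp)
    show "(\<psi> \<circ> a) i (c (0, m)) = c (0, \<pi> i m)" if "i \<in> {1..n}" for i m
      using that c(2)[of "int i"] c(2)[of "- int i"] by (simp add: \<psi>_a \<tau>_c)
  qed (use \<pi>(1) w(1) in auto)
  then have "word_eval ?S (\<psi> \<circ> a) w (c (0, length w)) \<noteq> c (0, length w)"
    using \<pi>(2) w(2) c(1) by (auto simp: bij_def inj_eq)
  then have "word_eval ?S (\<psi> \<circ> a) w \<noteq> \<one>\<^bsub>?S\<^esub>" by auto
  then have "word_eval K a w \<noteq> \<one>\<^bsub>K\<^esub>"
    using \<psi>.hom_word_eval[OF a w(1)] by (metis \<psi>.hom_one)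
  with a show ?thesis by blast
qed

end

section \<open>Isomorphic groups have the same properties\<close>

text \<open>The HNN extension consists of classes of words and its enumerated copy of numbers. As the two groups
  have different types, each property has to be carried over by hand.\<close>

locale inverse_group_homs = f: group_hom G H f + g: group_hom H G g
  for G (structure) and H (structure) and f g +
  assumes gf: "x \<in> carrier G \<Longrightarrow> g (f x) = x" and fg: "y \<in> carrier H \<Longrightarrow> f (g y) = y"
begin

lemma g_eq_iff [simp]: "x \<in> carrier H \<Longrightarrow> y \<in> carrier H \<Longrightarrow> g x = g y \<longleftrightarrow> x = y"
  using fg by metis

lemma f_eq_iff [simp]: "x \<in> carrier G \<Longrightarrow> y \<in> carrier G \<Longrightarrow> f x = f y \<longleftrightarrow> x = y"
  using gf by metis

lemma g_eq_one_iff [simp]: "x \<in> carrier H \<Longrightarrow> g x = \<one>\<^bsub>G\<^esub> \<longleftrightarrow> x = \<one>\<^bsub>H\<^esub>"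
  using g_eq_iff[of x "\<one>\<^bsub>H\<^esub>"] by (simp del: g_eq_iff)

lemma f_eq_one_iff [simp]: "x \<in> carrier G \<Longrightarrow> f x = \<one>\<^bsub>H\<^esub> \<longleftrightarrow> x = \<one>\<^bsub>G\<^esub>"
  using f_eq_iff[of x "\<one>\<^bsub>G\<^esub>"] by (simp del: f_eq_iff)

lemma g_image_carrier: "g ` carrier H = carrier G"
proof
  show "carrier G \<subseteq> g ` carrier H"
    using gf f.hom_closed by (metis image_eqI subsetI)
qed auto

lemma g_image_subset: "A \<subseteq> carrier H \<Longrightarrow> g ` A \<subseteq> carrier G"
  by auto

lemma amenable_transfer:
  assumes "amenable G"
  shows "amenable H"
proof -
  obtain \<mu> :: "'a set \<Rightarrow> real" where \<mu>: "\<mu> (carrier G) = 1"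
    "\<forall>A \<subseteq> carrier G. 0 \<le> \<mu> A"
    "\<forall>A \<subseteq> carrier G. \<forall>B \<subseteq> carrier G. A \<inter> B = {} \<longrightarrow> \<mu> (A \<union> B) = \<mu> A + \<mu> B"
    "\<forall>x \<in> carrier G. \<forall>A \<subseteq> carrier G. \<mu> (x <#\<^bsub>G\<^esub> A) = \<mu> A"
    using assms unfolding amenable_def by (elim exE conjE)
  have disj: "g ` A \<inter> g ` B = {}" if "A \<subseteq> carrier H" "B \<subseteq> carrier H" "A \<inter> B = {}" for A B
  proof -
    have "inj_on g (carrier H)" by (simp add: inj_on_def)
    from inj_on_image_Int[OF this that(1,2)] that(3) show ?thesis by simp
  qed
  have coset: "g ` (x <#\<^bsub>H\<^esub> A) = g x <#\<^bsub>G\<^esub> g ` A" if "x \<in> carrier H" "A \<subseteq> carrier H" for x A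
    using that by (force simp: l_coset_def image_iff subset_iff)
  show ?thesis
    unfolding amenable_def
  proof (intro exI[of _ "\<lambda>A. \<mu> (g ` A)"] conjI allI ballI impI)
    show "\<mu> (g ` carrier H) = 1" by (simp add: g_image_carrier \<mu>(1))
    show "0 \<le> \<mu> (g ` A)" if "A \<subseteq> carrier H" for A
      using that \<mu>(2) g_image_subset by blast
    show "\<mu> (g ` (A \<union> B)) = \<mu> (g ` A) + \<mu> (g ` B)"
      if "A \<subseteq> carrier H" "B \<subseteq> carrier H" "A \<inter> B = {}" for A B
      unfolding image_Un
      using that by (intro \<mu>(3)[rule_format] g_image_subset disj)
    show "\<mu> (g ` (x <#\<^bsub>H\<^esub> A)) = \<mu> (g ` A)" if "x \<in> carrier H" "A \<subseteq> carrier H" for x A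
      unfolding coset[OF that] using that by (intro \<mu>(4)[rule_format] g_image_subset g.hom_closed)
  qed
qed

lemma no_F2_subgroup_transfer:
  assumes "no_F2_subgroup G"
  shows "no_F2_subgroup H"
  unfolding no_F2_subgroup_def
proof
  assume "\<exists>L. subgroup L H \<and> H\<lparr>carrier := L\<rparr> \<cong> free_group (UNIV :: bool set)"
  then obtain L where L: "subgroup L H" "H\<lparr>carrier := L\<rparr> \<cong> free_group (UNIV :: bool set)"
    by blast
  have L_sub: "L \<subseteq> carrier H" using L(1) by (rule subgroup.subset)
  have "g \<in> iso (H\<lparr>carrier := L\<rparr>) (G\<lparr>carrier := g ` L\<rparr>)"
    using L_sub by (intro isoI homI) (auto simp: bij_betw_def inj_on_def subset_iff)
  then have "H\<lparr>carrier := L\<rparr> \<cong> G\<lparr>carrier := g ` L\<rparr>" by (auto simp: is_iso_def)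
  then have "G\<lparr>carrier := g ` L\<rparr> \<cong> H\<lparr>carrier := L\<rparr>"
    using group.iso_sym f.H.subgroup_imp_group[OF L(1)] by blast
  then have "G\<lparr>carrier := g ` L\<rparr> \<cong> free_group (UNIV :: bool set)"
    using L(2) by (rule iso_trans)
  moreover have "subgroup (g ` L) G" using L(1) by (rule g.subgroup_img_is_subgroup)
  ultimately show False using assms unfolding no_F2_subgroup_def by blast
qed

lemma linear_order_pullback:
  assumes "linear_order_on (carrier G) r"
  shows "linear_order_on (carrier H) {(x, y). x \<in> carrier H \<and> y \<in> carrier H \<and> (g x, g y) \<in> r}"
    (is "linear_order_on _ ?r'")
proof -
  have r: "\<And>x. x \<in> carrier G \<Longrightarrow> (x, x) \<in> r" "trans r" "antisym r" "total_on (carrier G) r"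
    using assms
    by (auto simp: linear_order_on_def partial_order_on_def preorder_on_def refl_on_def)
  have "refl_on (carrier H) ?r'" using r(1) by (simp add: refl_on_def)
  moreover have "trans ?r'" using transD[OF r(2)] by (intro transI) blast
  moreover have "antisym ?r'"
    using antisymD[OF r(3)] by (intro antisymI) (auto simp flip: g_eq_iff)
  moreover have "total_on (carrier H) ?r'" using r(4) by (auto simp: total_on_def)
  ultimately show ?thesis
    by (auto simp: linear_order_on_def partial_order_on_def preorder_on_def)
qed

lemma left_orderable_transfer:
  assumes "left_orderable G"
  shows "left_orderable H"
proof -
  obtain r where r: "linear_order_on (carrier G) r"
    "\<And>x y z. (x, y) \<in> r \<Longrightarrow> z \<in> carrier G \<Longrightarrow> (z \<otimes>\<^bsub>G\<^esub> x, z \<otimes>\<^bsub>G\<^esub> y) \<in> r"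
    using assms unfolding left_orderable_def by blast
  show ?thesis
    unfolding left_orderable_def
    using linear_order_pullback[OF r(1)] r(2)
    by (intro exI[of _ "{(x, y). x \<in> carrier H \<and> y \<in> carrier H \<and> (g x, g y) \<in> r}"]) simp
qed

lemma biorderable_transfer:
  assumes "biorderable G"
  shows "biorderable H"
proof -
  obtain r where r: "linear_order_on (carrier G) r"
    "\<And>x y z. (x, y) \<in> r \<Longrightarrow> z \<in> carrier G \<Longrightarrow> (z \<otimes>\<^bsub>G\<^esub> x, z \<otimes>\<^bsub>G\<^esub> y) \<in> r"
    "\<And>x y z. (x, y) \<in> r \<Longrightarrow> z \<in> carrier G \<Longrightarrow> (x \<otimes>\<^bsub>G\<^esub> z, y \<otimes>\<^bsub>G\<^esub> z) \<in> r"
    using assms unfolding biorderable_def by blast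
  show ?thesis
    unfolding biorderable_def
    using linear_order_pullback[OF r(1)] r(2,3)
    by (intro exI[of _ "{(x, y). x \<in> carrier H \<and> y \<in> carrier H \<and> (g x, g y) \<in> r}"]) simp
qed

text \<open>The infinite cyclic quotient of the corresponding subgroup of \<open>G\<close> is turned into a homomorphism
  onto \<open>\<int>\<close>, which can be composed with \<open>g\<close>; its kernel is the normal subgroup sought.\<close>

lemma locally_indicable_transfer:
  assumes "locally_indicable G"
  shows "locally_indicable H"
  unfolding locally_indicable_def
proof (intro allI impI)
  fix S L
  assume "finite S \<and> S \<subseteq> carrier H \<and> L = generate H S \<and> L \<noteq> {\<one>\<^bsub>H\<^esub>}"
  then have S: "finite S" "S \<subseteq> carrier H" and L: "L = generate H S" "L \<noteq> {\<one>\<^bsub>H\<^esub>}" by auto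
  have gL: "g ` L = generate G (g ` S)"
    using g.generate_img[OF S(2)] by (simp add: L(1))
  have subL: "subgroup L H" unfolding L(1) using S(2) by (rule f.H.generate_is_subgroup)
  have L_sub: "L \<subseteq> carrier H" using subL by (rule subgroup.subset)
  have "g ` L \<noteq> {\<one>\<^bsub>G\<^esub>}"
  proof
    assume "g ` L = {\<one>\<^bsub>G\<^esub>}"
    then have "x = \<one>\<^bsub>H\<^esub>" if "x \<in> L" for x
      using that L_sub by (metis g_eq_one_iff image_eqI singletonD subsetD)
    then show False using L(2) subgroup.one_closed[OF subL] by blast
  qed
  with S gL assms obtain N where N: "N \<lhd> G\<lparr>carrier := g ` L\<rparr>"
    "(G\<lparr>carrier := g ` L\<rparr> Mod N) \<cong> integer_group"
    unfolding locally_indicable_def by (metis finite_imageI g_image_subset)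
  obtain \<theta> where \<theta>: "\<theta> \<in> iso (G\<lparr>carrier := g ` L\<rparr> Mod N) integer_group"
    using N(2) by (auto simp: is_iso_def)
  interpret N: normal N "G\<lparr>carrier := g ` L\<rparr>" by (rule N(1))
  let ?q = "\<lambda>x. N #>\<^bsub>G\<lparr>carrier := g ` L\<rparr>\<^esub> x"
  define \<chi> where "\<chi> = \<theta> \<circ> (?q \<circ> g)"
  have "g \<in> hom (H\<lparr>carrier := L\<rparr>) (G\<lparr>carrier := g ` L\<rparr>)"
    using L_sub by (intro homI) (auto simp: subset_iff)
  then have "\<chi> \<in> hom (H\<lparr>carrier := L\<rparr>) integer_group"
    unfolding \<chi>_def using \<theta> N.r_coset_hom_Mod by (meson Group.hom_compose iso_imp_homomorphism)
  then interpret \<chi>: group_hom "H\<lparr>carrier := L\<rparr>" integer_group \<chi>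
    using f.H.subgroup_imp_group[OF subL] by (simp add: group_hom_def group_hom_axioms_def)
  have "\<chi> ` carrier (H\<lparr>carrier := L\<rparr>) = \<theta> ` (?q ` (g ` L))"
    by (simp add: \<chi>_def image_comp)
  also have "?q ` (g ` L) = carrier (G\<lparr>carrier := g ` L\<rparr> Mod N)"
    by (auto simp: FactGroup_def RCOSETS_def)
  also have "\<theta> ` \<dots> = carrier integer_group"
    using \<theta> by (simp add: iso_def bij_betw_def)
  finally have "(H\<lparr>carrier := L\<rparr> Mod kernel (H\<lparr>carrier := L\<rparr>) integer_group \<chi>) \<cong> integer_group"
    by (rule \<chi>.FactGroup_iso)
  then show "\<exists>N. N \<lhd> H\<lparr>carrier := L\<rparr> \<and> (H\<lparr>carrier := L\<rparr> Mod N) \<cong> integer_group"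
    using \<chi>.normal_kernel by blast
qed

lemma unique_product_property_transfer:
  assumes "unique_product_property G"
  shows "unique_product_property H"
  unfolding unique_product_property_def
proof (intro allI impI)
  fix X Y
  assume *: "finite X \<and> finite Y \<and> X \<noteq> {} \<and> Y \<noteq> {} \<and> X \<subseteq> carrier H \<and> Y \<subseteq> carrier H"
  then have "finite (g ` X) \<and> finite (g ` Y) \<and> g ` X \<noteq> {} \<and> g ` Y \<noteq> {}
      \<and> g ` X \<subseteq> carrier G \<and> g ` Y \<subseteq> carrier G"
    by auto
  then obtain z where "\<exists>!p. p \<in> g ` X \<times> g ` Y \<and> fst p \<otimes>\<^bsub>G\<^esub> snd p = z"
    using assms unfolding unique_product_property_def by metis
  then obtain p where p: "p \<in> g ` X \<times> g ` Y" "fst p \<otimes>\<^bsub>G\<^esub> snd p = z"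
    "\<And>q. q \<in> g ` X \<times> g ` Y \<Longrightarrow> fst q \<otimes>\<^bsub>G\<^esub> snd q = z \<Longrightarrow> q = p"
    by (elim ex1E) blast
  from p(1) obtain x y where xy: "x \<in> X" "y \<in> Y" "p = (g x, g y)" by auto
  have "\<exists>!p. p \<in> X \<times> Y \<and> fst p \<otimes>\<^bsub>H\<^esub> snd p = x \<otimes>\<^bsub>H\<^esub> y"
  proof (rule ex1I[of _ "(x, y)"])
    fix q assume q: "q \<in> X \<times> Y \<and> fst q \<otimes>\<^bsub>H\<^esub> snd q = x \<otimes>\<^bsub>H\<^esub> y"
    have in_H: "x \<in> carrier H" "y \<in> carrier H" "fst q \<in> carrier H" "snd q \<in> carrier H"
      using q xy * by auto
    have "g (fst q) \<otimes>\<^bsub>G\<^esub> g (snd q) = g x \<otimes>\<^bsub>G\<^esub> g y"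
      using q in_H by (simp flip: g.hom_mult)
    then have "(g (fst q), g (snd q)) = (g x, g y)"
      using p(3)[of "(g (fst q), g (snd q))"] p(2) q xy by auto
    then show "q = (x, y)"
      using in_H by (simp add: prod_eq_iff)
  qed (use xy in auto)
  then show "\<exists>z. \<exists>!p. p \<in> X \<times> Y \<and> fst p \<otimes>\<^bsub>H\<^esub> snd p = z" by blast
qed

lemma torsion_free_transfer:
  assumes "torsion_free G"
  shows "torsion_free H"
  unfolding torsion_free_def
proof (intro ballI allI impI)
  fix x and n :: nat
  assume x: "x \<in> carrier H" "0 < n \<and> x [^]\<^bsub>H\<^esub> n = \<one>\<^bsub>H\<^esub>"
  then have "g x [^]\<^bsub>G\<^esub> n = \<one>\<^bsub>G\<^esub>" by (simp flip: g.hom_nat_pow)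
  then have "g x = \<one>\<^bsub>G\<^esub>" using assms x unfolding torsion_free_def by auto
  then show "x = \<one>\<^bsub>H\<^esub>" using x by simp
qed

lemma sofic_transfer:
  assumes "sofic G"
  shows "sofic H"
  unfolding sofic_def
proof (intro allI impI)
  fix F and \<epsilon> :: real
  assume \<epsilon>: "\<epsilon> > 0" and F: "finite F \<and> F \<subseteq> carrier H"
  then have "finite (g ` F) \<and> g ` F \<subseteq> carrier G" by auto
  then obtain n \<sigma> where n: "n > 0" and \<sigma>: "\<forall>x \<in> carrier G. \<sigma> x permutes {..<n}"
    "\<forall>x \<in> g ` F. \<forall>y \<in> g ` F. hamming_dist n (\<sigma> (x \<otimes>\<^bsub>G\<^esub> y)) (\<sigma> x \<circ> \<sigma> y) < \<epsilon>"
    "\<forall>x \<in> g ` F - {\<one>\<^bsub>G\<^esub>}. hamming_dist n (\<sigma> x) id > 1 - \<epsilon>"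
    using assms \<epsilon> unfolding sofic_def by metis
  have F': "x \<in> carrier H" if "x \<in> F" for x using F that by blast
  show "\<exists>n > 0. \<exists>\<sigma>. (\<forall>x \<in> carrier H. \<sigma> x permutes {..<n}) \<and>
      (\<forall>x \<in> F. \<forall>y \<in> F. hamming_dist n (\<sigma> (x \<otimes>\<^bsub>H\<^esub> y)) (\<sigma> x \<circ> \<sigma> y) < \<epsilon>) \<and>
      (\<forall>x \<in> F - {\<one>\<^bsub>H\<^esub>}. hamming_dist n (\<sigma> x) id > 1 - \<epsilon>)"
  proof (intro exI conjI ballI)
    show "(\<sigma> \<circ> g) x permutes {..<n}" if "x \<in> carrier H" for x using that \<sigma>(1) by simp
    show "hamming_dist n ((\<sigma> \<circ> g) (x \<otimes>\<^bsub>H\<^esub> y)) ((\<sigma> \<circ> g) x \<circ> (\<sigma> \<circ> g) y) < \<epsilon>"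
      if "x \<in> F" "y \<in> F" for x y
      using that \<sigma>(2) F' by simp
    show "hamming_dist n ((\<sigma> \<circ> g) x) id > 1 - \<epsilon>" if "x \<in> F - {\<one>\<^bsub>H\<^esub>}" for x
      using that \<sigma>(3) F' by auto
  qed (rule n)
qed

lemma no_law_transfer:
  assumes "no_law G"
  shows "no_law H"
  unfolding no_law_def
proof (intro allI ballI impI)
  fix n :: nat and w assume w: "w \<in> words {1..n}" "w \<noteq> [] \<and> freely_reduced w"
  then obtain a where a: "a \<in> {1..n} \<rightarrow> carrier G" "word_eval G a w \<noteq> \<one>\<^bsub>G\<^esub>"
    using assms unfolding no_law_def by blast
  have "f \<circ> a \<in> {1..n} \<rightarrow> carrier H" using a(1) by (simp add: Pi_iff)
  moreover have "word_eval H (f \<circ> a) w \<noteq> \<one>\<^bsub>H\<^esub>"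
    using f.hom_word_eval[OF a(1) w(1)] a(2) f.G.word_eval_closed[OF a(1) w(1)]
      f_eq_one_iff by metis
  ultimately show "\<exists>a \<in> {1..n} \<rightarrow> carrier H. word_eval H a w \<noteq> \<one>\<^bsub>H\<^esub>" by blast
qed

lemma has_property_transfer: "has_property G P \<Longrightarrow> has_property H P"
  by (cases P)
    (auto intro: amenable_transfer no_F2_subgroup_transfer left_orderable_transfer
      locally_indicable_transfer biorderable_transfer unique_product_property_transfer
      torsion_free_transfer sofic_transfer no_law_transfer)

end

section \<open>Groups with one nontrivial conjugacy class\<close>

context group
begin

lemma one_nontrivial_conjugacy_classI:
  assumes conj: "\<And>f g. f \<in> carrier G - {\<one>} \<Longrightarrow> g \<in> carrier G - {\<one>} \<Longrightarrow>
      \<exists>h \<in> carrier G. h \<otimes> f \<otimes> inv h = g"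
    and nontrivial: "carrier G \<noteq> {\<one>}"
  shows "one_nontrivial_conjugacy_class G"
proof -
  let ?\<phi> = "\<lambda>g x. g \<otimes> x \<otimes> inv g"
  have nontriv_orbit: "orbit G ?\<phi> x = carrier G - {\<one>}" if x: "x \<in> carrier G - {\<one>}" for x
  proof
    show "orbit G ?\<phi> x \<subseteq> carrier G - {\<one>}"
    proof
      fix y assume "y \<in> orbit G ?\<phi> x"
      then obtain h where h: "h \<in> carrier G" "y = h \<otimes> x \<otimes> inv h"
        by (auto simp: orbit_def)
      have "y \<noteq> \<one>"
      proof
        assume "y = \<one>"
        then have "h \<otimes> x = h" using h x by (simp add: inv_solve_right')
        then show False using h x by simp
      qed
      then show "y \<in> carrier G - {\<one>}" using h x by simp
    qed
    show "carrier G - {\<one>} \<subseteq> orbit G ?\<phi> x"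
      using conj[OF x] by (force simp: orbit_def)
  qed
  have triv_orbit: "orbit G ?\<phi> \<one> = {\<one>}"
    by (auto simp: orbit_def intro: exI[of _ "\<one>"])
  obtain x where x: "x \<in> carrier G - {\<one>}"
    using nontrivial one_closed by blast
  have classes: "C \<in> conjugacy_classes G \<longleftrightarrow> (\<exists>x \<in> carrier G. C = orbit G ?\<phi> x)" for C
    by (auto simp: conjugacy_classes_def orbits_def)
  show ?thesis
    unfolding one_nontrivial_conjugacy_class_def
  proof (rule ex1I[of _ "carrier G - {\<one>}"])
    show "carrier G - {\<one>} \<in> conjugacy_classes G \<and> carrier G - {\<one>} \<noteq> {\<one>}"
      using nontriv_orbit[OF x] x by (auto simp: classes)
    show "C = carrier G - {\<one>}" if "C \<in> conjugacy_classes G \<and> C \<noteq> {\<one>}" for C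
      using that nontriv_orbit triv_orbit unfolding classes by blast
  qed
qed

lemma is_simpleI:
  assumes conj: "\<And>f g. f \<in> carrier G - {\<one>} \<Longrightarrow> g \<in> carrier G - {\<one>} \<Longrightarrow>
      \<exists>h \<in> carrier G. h \<otimes> f \<otimes> inv h = g"
    and nontrivial: "carrier G \<noteq> {\<one>}"
  shows "is_simple G"
  unfolding is_simple_def
proof (intro conjI allI impI)
  fix N assume N: "N \<lhd> G"
  then interpret N: normal N G .
  show "N = carrier G \<or> N = {\<one>}"
  proof (rule disjCI)
    assume "N \<noteq> {\<one>}"
    then obtain f where f: "f \<in> N" "f \<noteq> \<one>" using N.one_closed by blast
    have "g \<in> N" if g: "g \<in> carrier G" "g \<noteq> \<one>" for g
    proof -
      obtain h where "h \<in> carrier G" "h \<otimes> f \<otimes> inv h = g"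
        using conj[of f g] f g N.subset by auto
      then show ?thesis using N.inv_op_closed2[OF _ f(1)] by auto
    qed
    then show "N = carrier G" using N.subset N.one_closed by blast
  qed
qed (use nontrivial in auto)

text \<open>A word that is not a law has some nontrivial value; every \<open>f \<noteq> \<one>\<close> is a conjugate of it, and a
  conjugate of a value of a word is again a value of that word.\<close>

lemma verbally_completeI:
  assumes conj: "\<And>f g. f \<in> carrier G - {\<one>} \<Longrightarrow> g \<in> carrier G - {\<one>} \<Longrightarrow>
      \<exists>h \<in> carrier G. h \<otimes> f \<otimes> inv h = g"
    and law: "no_law G"
  shows "verbally_complete G"
  unfolding verbally_complete_def
proof (intro allI ballI impI)
  fix n :: nat and w f
  assume w: "w \<in> words {1..n}" "w \<noteq> [] \<and> freely_reduced w" and f: "f \<in> carrier G"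
  show "\<exists>g \<in> {1..n} \<rightarrow> carrier G. word_eval G g w = f"
  proof (cases "f = \<one>")
    case True
    then show ?thesis
      by (intro bexI[of _ "\<lambda>_. \<one>"]) (simp_all add: word_eval_const_one)
  next
    case False
    obtain a where a: "a \<in> {1..n} \<rightarrow> carrier G" "word_eval G a w \<noteq> \<one>"
      using law w unfolding no_law_def by blast
    have "word_eval G a w \<in> carrier G" using a(1) w(1) by (rule word_eval_closed)
    then obtain h where h: "h \<in> carrier G" "h \<otimes> word_eval G a w \<otimes> inv h = f"
      using conj[of "word_eval G a w" f] a(2) f False by auto
    interpret h: group_hom G G "\<lambda>x. h \<otimes> x \<otimes> inv h"
      using conjugation_hom[OF h(1)] by unfold_locales
    have "word_eval G ((\<lambda>x. h \<otimes> x \<otimes> inv h) \<circ> a) w = f"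
      using h.hom_word_eval[OF a(1) w(1)] h(2) by simp
    moreover have "(\<lambda>x. h \<otimes> x \<otimes> inv h) \<circ> a \<in> {1..n} \<rightarrow> carrier G"
      using a(1) h(1) by (auto simp: Pi_iff)
    ultimately show ?thesis by blast
  qed
qed

end

section \<open>The space of enumerated groups\<close>

lemma group_of_simps [simp]:
  "carrier (group_of c) = UNIV"
  "x \<otimes>\<^bsub>group_of c\<^esub> y = fst c (x, y)"
  "\<one>\<^bsub>group_of c\<^esub> = snd (snd c)"
  by (simp_all add: group_of_def split_beta)

definition groups_with :: "group_property \<Rightarrow> enumerated set" where
  "groups_with P = {c \<in> enumerated_groups. has_property (group_of c) P}"

lemma enumerated_space_eq: "enumerated_space P = top_of_set (groups_with P)"
  by (simp add: enumerated_space_def groups_with_def)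

lemma groups_withD:
  assumes "c \<in> groups_with P"
  shows "group (group_of c)" "has_property (group_of c) P"
    "inv\<^bsub>group_of c\<^esub> x = fst (snd c) x"
  using assms by (auto simp: groups_with_def enumerated_groups_def)

text \<open>Basic open sets of the product topology restrict finitely many coordinates.\<close>

lemma open_function_space_finitely_determined:
  fixes W :: "('i \<Rightarrow> nat) set"
  assumes "open W" "x \<in> W"
  obtains D where "finite D" "\<And>y. (\<And>i. i \<in> D \<Longrightarrow> y i = x i) \<Longrightarrow> y \<in> W"
proof -
  have "openin (product_topology (\<lambda>_. euclidean) UNIV) W"
    using assms(1) by (simp add: open_fun_def)
  from product_topology_open_contains_basis[OF this assms(2)]
  obtain X where X: "x \<in> (\<Pi>\<^sub>E i\<in>UNIV. X i)" "finite {i. X i \<noteq> UNIV}" "(\<Pi>\<^sub>E i\<in>UNIV. X i) \<subseteq> W"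
    by auto
  show thesis
  proof (rule that[OF X(2)])
    fix y assume y: "\<And>i. i \<in> {i. X i \<noteq> UNIV} \<Longrightarrow> y i = x i"
    have "y i \<in> X i" for i
      using X(1) y[of i] by (cases "X i = UNIV") (auto simp: PiE_iff)
    then show "y \<in> W" using X(3) by (auto simp: PiE_iff)
  qed
qed

definition agree_on :: "nat set \<Rightarrow> enumerated \<Rightarrow> enumerated \<Rightarrow> bool" where
  "agree_on F c c' \<longleftrightarrow> (\<forall>x \<in> F. \<forall>y \<in> F. fst c' (x, y) = fst c (x, y)) \<and>
     (\<forall>x \<in> F. fst (snd c') x = fst (snd c) x) \<and> snd (snd c') = snd (snd c)"

lemma open_enumerated_finitely_determined:
  fixes W :: "enumerated set"
  assumes "open W" "c \<in> W"
  obtains F where "finite F" "\<And>c'. agree_on F c c' \<Longrightarrow> c' \<in> W"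
proof -
  obtain A B where AB: "open A" "open B" "c \<in> A \<times> B" "A \<times> B \<subseteq> W"
    using open_prod_elim[OF assms] by metis
  have "snd c \<in> B" using AB(3) by (auto simp: mem_Times_iff)
  then obtain B1 B2 where B: "open B1" "open B2" "snd c \<in> B1 \<times> B2" "B1 \<times> B2 \<subseteq> B"
    using open_prod_elim[OF AB(2)] by metis
  have mem: "fst c \<in> A" "fst (snd c) \<in> B1" "snd (snd c) \<in> B2"
    using AB(3) B(3) by (auto simp: mem_Times_iff)
  obtain D where D: "finite D" "\<And>y. (\<And>i. i \<in> D \<Longrightarrow> y i = fst c i) \<Longrightarrow> y \<in> A"
    using open_function_space_finitely_determined[OF AB(1) mem(1)] by blast
  obtain E where E: "finite E" "\<And>y. (\<And>i. i \<in> E \<Longrightarrow> y i = fst (snd c) i) \<Longrightarrow> y \<in> B1"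
    using open_function_space_finitely_determined[OF B(1) mem(2)] by blast
  define F where "F = fst ` D \<union> snd ` D \<union> E"
  show thesis
  proof (rule that)
    show "finite F" using D(1) E(1) by (simp add: F_def)
    fix c' assume agree: "agree_on F c c'"
    have "fst c' i = fst c i" if "i \<in> D" for i
    proof -
      have "fst i \<in> F" "snd i \<in> F" using that by (auto simp: F_def)
      then show ?thesis using agree unfolding agree_on_def by (metis prod.collapse)
    qed
    then have "fst c' \<in> A" by (rule D(2))
    moreover have "fst (snd c') \<in> B1"
      using agree by (intro E(2)) (auto simp: agree_on_def F_def)
    moreover have "snd (snd c') \<in> B2"
      using agree mem(3) by (simp add: agree_on_def)
    ultimately have "fst c' \<in> A" "snd c' \<in> B"
      using B(4) by (auto simp: mem_Times_iff)
    then show "c' \<in> W"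
      using AB(4) by (auto simp: mem_Times_iff)
  qed
qed

text \<open>Meant for mutually inverse bijections \<open>\<theta>\<close> and \<open>\<eta>\<close> between the group and \<open>\<nat>\<close>.\<close>

definition transported :: "('k, 'r) monoid_scheme \<Rightarrow> ('k \<Rightarrow> nat) \<Rightarrow> (nat \<Rightarrow> 'k) \<Rightarrow> enumerated" where
  "transported K \<theta> \<eta> =
     (\<lambda>(x, y). \<theta> (\<eta> x \<otimes>\<^bsub>K\<^esub> \<eta> y), \<lambda>x. \<theta> (inv\<^bsub>K\<^esub> \<eta> x), \<theta> \<one>\<^bsub>K\<^esub>)"

lemma transported_enumerated_group:
  assumes K: "group K" and \<theta>: "\<And>x. x \<in> carrier K \<Longrightarrow> \<eta> (\<theta> x) = x"
    and \<eta>: "\<And>n. \<eta> n \<in> carrier K" "\<And>n. \<theta> (\<eta> n) = n"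
  shows "transported K \<theta> \<eta> \<in> enumerated_groups"
    and "inverse_group_homs K (group_of (transported K \<theta> \<eta>)) \<theta> \<eta>"
proof -
  interpret K: group K by (rule K)
  let ?G = "group_of (transported K \<theta> \<eta>)"
  have mult: "fst (transported K \<theta> \<eta>) (x, y) = \<theta> (\<eta> x \<otimes>\<^bsub>K\<^esub> \<eta> y)" for x y
    by (simp add: transported_def)
  have one: "snd (snd (transported K \<theta> \<eta>)) = \<theta> \<one>\<^bsub>K\<^esub>" by (simp add: transported_def)
  have G: "group ?G"
  proof (rule groupI)
    fix x assume "x \<in> carrier ?G"
    show "\<exists>y \<in> carrier ?G. y \<otimes>\<^bsub>?G\<^esub> x = \<one>\<^bsub>?G\<^esub>"
      by (intro bexI[of _ "\<theta> (inv\<^bsub>K\<^esub> \<eta> x)"]) (simp_all add: mult one \<theta> \<eta>)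
  qed (simp_all add: mult one \<theta> \<eta> K.m_assoc)
  then interpret G: group ?G .
  have "inv\<^bsub>?G\<^esub> x = fst (snd (transported K \<theta> \<eta>)) x" for x
    by (rule G.inv_equality) (simp_all add: mult one \<theta> \<eta>, simp add: transported_def \<theta> \<eta>)
  with G show "transported K \<theta> \<eta> \<in> enumerated_groups"
    by (simp add: enumerated_groups_def)
  have "\<theta> \<in> hom K ?G" "\<eta> \<in> hom ?G K"
    by (auto intro!: homI simp: mult \<theta> \<eta>)
  then show "inverse_group_homs K ?G \<theta> \<eta>"
    by unfold_locales (simp_all add: \<theta> \<eta>)
qed

text \<open>\<open>E\<close> contains the indices at which the neighbourhood constrains the tables. Besides \<open>F\<close>, the names to be
  kept are these, the entries found in the tables at these indices, and the identity: then the tables of the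
  enumerated overgroup have the same entries there.\<close>

lemma overgroup_realized_nearby:
  assumes c: "c \<in> groups_with P" and T: "openin (enumerated_space P) T" "c \<in> T"
    and K: "group K" "has_property K P" "countable (carrier K)"
    and \<iota>: "\<iota> \<in> hom (group_of c) K" "inj \<iota>"
    and "finite F"
  obtains c' \<theta> \<eta> where "c' \<in> T" "inverse_group_homs K (group_of c') \<theta> \<eta>"
    "\<And>x. x \<in> F \<Longrightarrow> \<theta> (\<iota> x) = x"
proof -
  interpret c: group "group_of c" using c by (rule groups_withD)
  interpret \<iota>: group_hom "group_of c" K \<iota>
    using \<iota>(1) K(1) by (simp add: group_hom_def group_hom_axioms_def c.is_group)
  obtain W where W: "open W" "T = groups_with P \<inter> W"
    using T(1) by (auto simp: enumerated_space_eq openin_open)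
  obtain E where E: "finite E" "\<And>c'. agree_on E c c' \<Longrightarrow> c' \<in> W"
    using open_enumerated_finitely_determined[OF W(1), of c] T(2) W(2) by blast
  define D where "D = F \<union> fst c ` (E \<times> E) \<union> fst (snd c) ` E \<union> E \<union> {snd (snd c)}"
  have "finite D" using \<open>finite F\<close> E(1) by (simp add: D_def)
  have \<iota>_closed: "\<iota> x \<in> carrier K" for x using \<iota>.hom_closed by simp
  have inf: "infinite (carrier K)"
    using infinite_super[of "range \<iota>"] range_inj_infinite[OF \<iota>(2)] \<iota>_closed by blast
  have img: "finite (\<iota> ` D)" "inj_on (Hilbert_Choice.inv \<iota>) (\<iota> ` D)" "\<iota> ` D \<subseteq> carrier K"
    using \<open>finite D\<close> \<iota>_closed by (simp_all add: inj_on_inv_into image_subset_iff)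
  obtain \<theta> where \<theta>: "bij_betw \<theta> (carrier K) (UNIV :: nat set)"
    "\<And>y. y \<in> \<iota> ` D \<Longrightarrow> \<theta> y = Hilbert_Choice.inv \<iota> y"
    by (rule finite_injection_extends_to_bijection[OF img subset_UNIV K(3) inf countableI_type
          infinite_UNIV_nat]) blast
  have \<theta>\<iota>: "\<theta> (\<iota> x) = x" if "x \<in> D" for x
    using \<theta>(2) that \<iota>(2) by simp
  define \<eta> where "\<eta> = inv_into (carrier K) \<theta>"
  have \<eta>: "\<And>x. x \<in> carrier K \<Longrightarrow> \<eta> (\<theta> x) = x" "\<And>n. \<eta> n \<in> carrier K" "\<And>n. \<theta> (\<eta> n) = n"
    unfolding \<eta>_def using \<theta>(1)
    by (simp_all add: bij_betw_inv_into_left bij_betw_inv_into_right bij_betw_def inv_into_into)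
  have \<eta>_D: "\<eta> x = \<iota> x" if "x \<in> D" for x
    using \<eta>(1)[OF \<iota>_closed, of x] \<theta>\<iota>[OF that] by simp
  define c' where "c' = transported K \<theta> \<eta>"
  have homs: "inverse_group_homs K (group_of c') \<theta> \<eta>" and c': "c' \<in> enumerated_groups"
    unfolding c'_def using transported_enumerated_group[OF K(1), of \<eta> \<theta>] \<eta> by auto
  have "has_property (group_of c') P"
    using inverse_group_homs.has_property_transfer[OF homs K(2)] .
  moreover have "agree_on E c c'"
    unfolding agree_on_def
  proof (intro conjI ballI)
    fix x y assume xy: "x \<in> E" "y \<in> E"
    have "\<iota> x \<otimes>\<^bsub>K\<^esub> \<iota> y = \<iota> (fst c (x, y))" using \<iota>.hom_mult[of x y] by simp
    then show "fst c' (x, y) = fst c (x, y)"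
      using xy by (simp add: c'_def transported_def \<eta>_D \<theta>\<iota> D_def)
  next
    fix x assume x: "x \<in> E"
    have "inv\<^bsub>K\<^esub> \<iota> x = \<iota> (fst (snd c) x)"
      using \<iota>.hom_inv[of x] groups_withD(3)[OF c] by simp
    then show "fst (snd c') x = fst (snd c) x"
      using x by (simp add: c'_def transported_def \<eta>_D \<theta>\<iota> D_def)
  next
    show "snd (snd c') = snd (snd c)"
      using \<iota>.hom_one \<theta>\<iota>[of "snd (snd c)"] by (simp add: c'_def transported_def D_def)
  qed
  ultimately have "c' \<in> T"
    using E(2) W(2) c' by (simp add: groups_with_def)
  then show thesis
    using that homs \<theta>\<iota> by (simp add: D_def)
qed

section \<open>Two families of open sets\<close>

text \<open>The demand is void in groups where \<open>f\<close> or \<open>g\<close> happens to be the identity; this must be part of the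
  set, as one pair \<open>f, g\<close> of numbers is used for all groups at once.\<close>

definition groups_conjugating :: "group_property \<Rightarrow> nat \<Rightarrow> nat \<Rightarrow> enumerated set" where
  "groups_conjugating P f g = {c \<in> groups_with P.
     f = \<one>\<^bsub>group_of c\<^esub> \<or> g = \<one>\<^bsub>group_of c\<^esub> \<or>
     (\<exists>h. h \<otimes>\<^bsub>group_of c\<^esub> f \<otimes>\<^bsub>group_of c\<^esub> inv\<^bsub>group_of c\<^esub> h = g)}"

definition groups_violating :: "group_property \<Rightarrow> nat word \<Rightarrow> enumerated set" where
  "groups_violating P w = {c \<in> groups_with P. \<exists>a. word_eval (group_of c) a w \<noteq> \<one>\<^bsub>group_of c\<^esub>}"

text \<open>The indices at which the multiplication table is read may vary with the group: as \<open>\<nat>\<close> is discrete,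
  they are locally constant.\<close>

lemma continuous_on_product_of_nat_valued:
  fixes u v :: "enumerated \<Rightarrow> nat"
  assumes "continuous_on S u" "continuous_on S v"
  shows "continuous_on S (\<lambda>c. u c \<otimes>\<^bsub>group_of c\<^esub> v c)"
  unfolding continuous_on_def tendsto_discrete
proof
  fix x assume x: "x \<in> S"
  have "continuous_on S (\<lambda>c :: enumerated. fst c (u x, v x))"
    by (rule continuous_on_compose2[OF continuous_on_product_coordinates continuous_on_fst])
      (auto intro: continuous_on_id)
  then have "\<forall>\<^sub>F c in at x within S. fst c (u x, v x) = fst x (u x, v x)"
    using x by (simp add: continuous_on_def tendsto_discrete)
  moreover have "\<forall>\<^sub>F c in at x within S. u c = u x" "\<forall>\<^sub>F c in at x within S. v c = v x"
    using assms x by (simp_all add: continuous_on_def tendsto_discrete)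
  ultimately show "\<forall>\<^sub>F c in at x within S. u c \<otimes>\<^bsub>group_of c\<^esub> v c = u x \<otimes>\<^bsub>group_of x\<^esub> v x"
    by eventually_elim simp
qed

lemma continuous_on_one: "continuous_on S (\<lambda>c. \<one>\<^bsub>group_of c\<^esub>)"
  by (simp add: continuous_on_snd continuous_on_id)

lemma continuous_on_inv: "continuous_on (groups_with P) (\<lambda>c. inv\<^bsub>group_of c\<^esub> x)"
proof -
  have "continuous_on (groups_with P) (\<lambda>c :: enumerated. fst (snd c) x)"
    by (rule continuous_on_compose2[OF continuous_on_product_coordinates
          continuous_on_fst[OF continuous_on_snd]]) (auto intro: continuous_on_id)
  then show ?thesis
    by (rule continuous_on_eq) (simp add: groups_withD(3))
qed

lemma continuous_on_word_eval:
  "continuous_on (groups_with P) (\<lambda>c. word_eval (group_of c) a w)"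
proof (induction w)
  case Nil
  then show ?case unfolding word_eval_Nil by (rule continuous_on_one)
next
  case (Cons l w)
  obtain x b where l: "l = (x, b)" by force
  have "continuous_on (groups_with P) (\<lambda>c. if b then a x else inv\<^bsub>group_of c\<^esub> (a x))"
    by (cases b) (simp_all add: continuous_on_inv)
  then show ?case
    unfolding l word_eval_Cons using Cons by (rule continuous_on_product_of_nat_valued)
qed

lemma openin_enumerated_preimage:
  fixes u :: "enumerated \<Rightarrow> nat"
  assumes "continuous_on (groups_with P) u"
  shows "openin (enumerated_space P) {c \<in> groups_with P. u c \<in> B}"
proof -
  have "openin (top_of_set (groups_with P)) (groups_with P \<inter> u -` B)"
    using assms by (rule continuous_openin_preimage_gen) (rule open_discrete)
  moreover have "groups_with P \<inter> u -` B = {c \<in> groups_with P. u c \<in> B}" by auto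
  ultimately show ?thesis by (simp add: enumerated_space_eq)
qed

lemma openin_groups_conjugating: "openin (enumerated_space P) (groups_conjugating P f g)"
proof -
  let ?O = "\<lambda>u B. {c \<in> groups_with P. (u c :: nat) \<in> B}"
  have "continuous_on (groups_with P) (\<lambda>c. h \<otimes>\<^bsub>group_of c\<^esub> f \<otimes>\<^bsub>group_of c\<^esub> inv\<^bsub>group_of c\<^esub> h)" for h
    by (intro continuous_on_product_of_nat_valued continuous_on_inv continuous_on_const)
  then have "openin (enumerated_space P)
      (?O (\<lambda>c. h \<otimes>\<^bsub>group_of c\<^esub> f \<otimes>\<^bsub>group_of c\<^esub> inv\<^bsub>group_of c\<^esub> h) {g})" for h
    by (rule openin_enumerated_preimage)
  then have "openin (enumerated_space P)
      (\<Union>h. ?O (\<lambda>c. h \<otimes>\<^bsub>group_of c\<^esub> f \<otimes>\<^bsub>group_of c\<^esub> inv\<^bsub>group_of c\<^esub> h) {g})"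
    by (intro openin_Union) blast
  with openin_enumerated_preimage[OF continuous_on_one]
  have "openin (enumerated_space P)
      (?O (\<lambda>c. \<one>\<^bsub>group_of c\<^esub>) {f, g} \<union>
        (\<Union>h. ?O (\<lambda>c. h \<otimes>\<^bsub>group_of c\<^esub> f \<otimes>\<^bsub>group_of c\<^esub> inv\<^bsub>group_of c\<^esub> h) {g}))"
    by (rule openin_Un)
  also have "(?O (\<lambda>c. \<one>\<^bsub>group_of c\<^esub>) {f, g} \<union>
        (\<Union>h. ?O (\<lambda>c. h \<otimes>\<^bsub>group_of c\<^esub> f \<otimes>\<^bsub>group_of c\<^esub> inv\<^bsub>group_of c\<^esub> h) {g})) = groups_conjugating P f g"
    by (auto simp: groups_conjugating_def simp del: group_of_simps)
  finally show ?thesis .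
qed

lemma openin_groups_violating: "openin (enumerated_space P) (groups_violating P w)"
proof -
  let ?O = "\<lambda>u B. {c \<in> groups_with P. (u c :: nat) \<in> B}"
  have "openin (enumerated_space P)
      (?O (\<lambda>c. word_eval (group_of c) a w) {k} \<inter> ?O (\<lambda>c. \<one>\<^bsub>group_of c\<^esub>) (- {k}))" for a k
    by (intro openin_Int openin_enumerated_preimage continuous_on_word_eval continuous_on_one)
  then have "openin (enumerated_space P)
      (\<Union>k. ?O (\<lambda>c. word_eval (group_of c) a w) {k} \<inter> ?O (\<lambda>c. \<one>\<^bsub>group_of c\<^esub>) (- {k}))" for a
    by (intro openin_Union) blast
  then have "openin (enumerated_space P)
      (\<Union>a. \<Union>k. ?O (\<lambda>c. word_eval (group_of c) a w) {k} \<inter> ?O (\<lambda>c. \<one>\<^bsub>group_of c\<^esub>) (- {k}))"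
    by (intro openin_Union) blast
  also have "(\<Union>a. \<Union>k. ?O (\<lambda>c. word_eval (group_of c) a w) {k} \<inter> ?O (\<lambda>c. \<one>\<^bsub>group_of c\<^esub>) (- {k}))
      = groups_violating P w"
    by (auto simp: groups_violating_def simp del: group_of_simps) (metis, metis)
  finally show ?thesis .
qed

section \<open>Density\<close>

locale cyclic_hnn_closed_property =
  fixes P :: group_property
  assumes torsion_free_property: "property_of_torsion_free_groups P"
    and hnn_closed: "closed_under_cyclic_hnn P"
begin

lemma enumerable_torsion_free:
  assumes "c \<in> groups_with P"
  shows "enumerable_torsion_free_group (group_of c)"
  using groups_withD(1,2)[OF assms] torsion_free_property
  by (simp add: enumerable_torsion_free_group_def enumerable_torsion_free_group_axioms_def
      property_of_torsion_free_groups_def)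

lemma has_property_conjugating_hnn:
  assumes c: "c \<in> groups_with P" and fg: "f \<noteq> \<one>\<^bsub>group_of c\<^esub>" "g \<noteq> \<one>\<^bsub>group_of c\<^esub>"
  shows "has_property (conjugating_hnn (group_of c) f g) P"
proof -
  interpret c: enumerable_torsion_free_group "group_of c"
    using c by (rule enumerable_torsion_free)
  show ?thesis
    using hnn_closed c.infinite_cyclic_generate[OF c.torsion_free _ fg(1)]
      c.infinite_cyclic_generate[OF c.torsion_free _ fg(2)]
      c.power_map_iso[OF c.torsion_free _ fg(1) _ fg(2)] groups_withD(1,2)[OF c]
    unfolding closed_under_cyclic_hnn_def conjugating_hnn_def by (metis UNIV_I group_of_simps(1))
qed

lemma conjugating_hnn_nearby:
  assumes c: "c \<in> groups_with P" and T: "openin (enumerated_space P) T" "c \<in> T"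
    and fg: "f \<noteq> \<one>\<^bsub>group_of c\<^esub>" "g \<noteq> \<one>\<^bsub>group_of c\<^esub>" and "finite F"
  obtains c' \<theta> \<eta> where "c' \<in> T"
    "inverse_group_homs (conjugating_hnn (group_of c) f g) (group_of c') \<theta> \<eta>"
    "\<And>x. x \<in> F \<Longrightarrow>
      \<theta> (hnn_base (group_of c) (generate (group_of c) {f}) (power_map (group_of c) f g) x) = x"
proof -
  interpret c: enumerable_torsion_free_group "group_of c"
    using c by (rule enumerable_torsion_free)
  show thesis
  proof (rule overgroup_realized_nearby[OF c T, of "conjugating_hnn (group_of c) f g"])
    show "inj (hnn_base (group_of c) (generate (group_of c) {f}) (power_map (group_of c) f g))"
      using fg by (rule c.conjugating_hnn_base_inj)
    show "has_property (conjugating_hnn (group_of c) f g) P"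
      using c fg by (rule has_property_conjugating_hnn)
    show "hnn_base (group_of c) (generate (group_of c) {f}) (power_map (group_of c) f g)
        \<in> hom (group_of c) (conjugating_hnn (group_of c) f g)"
      unfolding conjugating_hnn_def by (rule hnn_base_hom[OF c.is_group])
    show "group (conjugating_hnn (group_of c) f g)"
      unfolding conjugating_hnn_def by (rule group_hnn_extension)
    show "countable (carrier (conjugating_hnn (group_of c) f g))"
      unfolding conjugating_hnn_def by (rule countable_hnn_extension) simp
  qed (use that \<open>finite F\<close> in blast)+
qed

text \<open>In the overgroup the stable letter conjugates \<open>f\<close> to \<open>g\<close>; its name conjugates them in the enumerated
  copy, where \<open>f\<close> and \<open>g\<close> have kept theirs.\<close>

lemma dense_groups_conjugating:
  "enumerated_space P closure_of groups_conjugating P f g = topspace (enumerated_space P)"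
  unfolding dense_intersects_open
proof (intro allI impI, elim conjE)
  fix T assume T: "openin (enumerated_space P) T" "T \<noteq> {}"
  then obtain c where cT: "c \<in> T" by blast
  then have c: "c \<in> groups_with P"
    using openin_subset[OF T(1)] by (auto simp: enumerated_space_eq)
  interpret c: enumerable_torsion_free_group "group_of c"
    using c by (rule enumerable_torsion_free)
  show "groups_conjugating P f g \<inter> T \<noteq> {}"
  proof (cases "f = \<one>\<^bsub>group_of c\<^esub> \<or> g = \<one>\<^bsub>group_of c\<^esub>")
    case True
    then have "c \<in> groups_conjugating P f g" using c unfolding groups_conjugating_def by blast
    then show ?thesis using cT by blast
  next
    case False
    then have fg: "f \<noteq> \<one>\<^bsub>group_of c\<^esub>" "g \<noteq> \<one>\<^bsub>group_of c\<^esub>" by auto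
    let ?K = "conjugating_hnn (group_of c) f g"
    let ?A = "generate (group_of c) {f}" and ?pm = "power_map (group_of c) f g"
    obtain c' \<theta> \<eta> where c': "c' \<in> T" "inverse_group_homs ?K (group_of c') \<theta> \<eta>"
      and \<theta>: "\<And>x. x \<in> {f, g} \<Longrightarrow> \<theta> (hnn_base (group_of c) ?A ?pm x) = x"
      by (rule conjugating_hnn_nearby[OF c T(1) cT fg, of "{f, g}"]) auto
    interpret \<theta>: inverse_group_homs ?K "group_of c'" \<theta> \<eta> by (rule c'(2))
    have "?pm f = g"
      using c.power_map_pow[OF c.torsion_free _ fg(1), of g 1] by simp
    moreover have "f \<in> ?A" by (simp add: generate.incl)
    ultimately have "stable_letter (group_of c) ?A ?pm \<otimes>\<^bsub>?K\<^esub> hnn_base (group_of c) ?A ?pm f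
        \<otimes>\<^bsub>?K\<^esub> inv\<^bsub>?K\<^esub> stable_letter (group_of c) ?A ?pm = hnn_base (group_of c) ?A ?pm g"
      using stable_letter_conjugates[of f ?A "group_of c" ?pm] by (simp add: conjugating_hnn_def)
    moreover have "stable_letter (group_of c) ?A ?pm \<in> carrier ?K"
      "hnn_base (group_of c) ?A ?pm f \<in> carrier ?K"
      by (simp_all add: conjugating_hnn_def stable_letter_closed hnn_base_closed)
    ultimately have "\<theta> (stable_letter (group_of c) ?A ?pm) \<otimes>\<^bsub>group_of c'\<^esub> f
        \<otimes>\<^bsub>group_of c'\<^esub> inv\<^bsub>group_of c'\<^esub> \<theta> (stable_letter (group_of c) ?A ?pm) = g"
      using \<theta>[of f] \<theta>[of g]
      by (metis \<theta>.f.hom_mult \<theta>.f.hom_inv \<theta>.f.G.m_closed \<theta>.f.G.inv_closed insertI1 insertI2)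
    moreover have "c' \<in> groups_with P"
      using c'(1) openin_subset[OF T(1)] by (auto simp: enumerated_space_eq)
    ultimately have "c' \<in> groups_conjugating P f g"
      unfolding groups_conjugating_def by blast
    then show ?thesis using c'(1) by blast
  qed
qed

text \<open>The stable letter commutes with \<open>g\<close>, the power of \<open>f\<close> with exponent \<open>n + 1\<close>. The demand names no element
  of the given group, so no name has to be kept beyond those that the neighbourhood constrains.\<close>

lemma dense_groups_violating:
  assumes w: "w \<in> words {1..n}" "w \<noteq> []" "freely_reduced w"
  shows "enumerated_space P closure_of groups_violating P w = topspace (enumerated_space P)"
  unfolding dense_intersects_open
proof (intro allI impI, elim conjE)
  fix T assume T: "openin (enumerated_space P) T" "T \<noteq> {}"
  then obtain c where cT: "c \<in> T" by blast
  then have c: "c \<in> groups_with P"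
    using openin_subset[OF T(1)] by (auto simp: enumerated_space_eq)
  interpret c: enumerable_torsion_free_group "group_of c"
    using c by (rule enumerable_torsion_free)
  obtain f where f: "f \<noteq> \<one>\<^bsub>group_of c\<^esub>" by (metis n_not_Suc_n)
  define g where "g = f [^]\<^bsub>group_of c\<^esub> (int n + 1)"
  have g: "g \<noteq> \<one>\<^bsub>group_of c\<^esub>"
    using c.torsion_free_int_pow_inj[OF c.torsion_free _ f, of "int n + 1" 0]
    by (simp add: g_def del: group_of_simps)
  obtain a where a: "a \<in> {1..n} \<rightarrow> carrier (conjugating_hnn (group_of c) g g)"
    "word_eval (conjugating_hnn (group_of c) g g) a w \<noteq> \<one>\<^bsub>conjugating_hnn (group_of c) g g\<^esub>"
    using c.conjugating_hnn_no_law[OF f w] unfolding g_def by blast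
  obtain c' \<theta> \<eta> where c': "c' \<in> T"
    "inverse_group_homs (conjugating_hnn (group_of c) g g) (group_of c') \<theta> \<eta>"
    by (rule conjugating_hnn_nearby[OF c T(1) cT g g, of "{}"]) auto
  interpret \<theta>: inverse_group_homs "conjugating_hnn (group_of c) g g" "group_of c'" \<theta> \<eta>
    by (rule c'(2))
  have "word_eval (group_of c') (\<theta> \<circ> a) w \<noteq> \<one>\<^bsub>group_of c'\<^esub>"
    using \<theta>.f.hom_word_eval[OF a(1) w(1)] a(2) \<theta>.f.G.word_eval_closed[OF a(1) w(1)]
      \<theta>.f_eq_one_iff by metis
  moreover have "c' \<in> groups_with P"
    using c'(1) openin_subset[OF T(1)] by (auto simp: enumerated_space_eq)
  ultimately have "c' \<in> groups_violating P w"
    unfolding groups_violating_def by blast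
  then show "groups_violating P w \<inter> T \<noteq> {}" using c'(1) by blast
qed

end

section \<open>Generic groups\<close>

theorem theorem1p2p1:
  fixes P :: group_property
  assumes "property_of_torsion_free_groups P"
    and "closed_under_cyclic_amalgamation P"
    and "closed_under_cyclic_hnn P"
  shows "\<exists>\<X>. comeager_in (enumerated_space P) \<X> \<and>
    (\<forall>c \<in> \<X>. one_nontrivial_conjugacy_class (group_of c) \<and>
       is_simple (group_of c) \<and> verbally_complete (group_of c))"
proof -
  interpret cyclic_hnn_closed_property P
    using assms(1,3) by unfold_locales
  define nontrivial_words where
    "nontrivial_words = {w :: nat word. w \<noteq> [] \<and> freely_reduced w \<and> (\<exists>n. w \<in> words {1..n})}"
  define \<U> where "\<U> = (\<lambda>(f, g). groups_conjugating P f g) ` UNIV \<union> groups_violating P ` nontrivial_words"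
  define \<X> where "\<X> = groups_with P \<inter> \<Inter>\<U>"
  have top: "topspace (enumerated_space P) = groups_with P"
    by (simp add: enumerated_space_eq)
  have "countable \<U>" by (simp add: \<U>_def)
  moreover have "openin (enumerated_space P) U \<and>
      enumerated_space P closure_of U = topspace (enumerated_space P)" if U: "U \<in> \<U>" for U
  proof -
    consider (conj) f g where "U = groups_conjugating P f g"
      | (law) w where "U = groups_violating P w" "w \<in> nontrivial_words"
      using U unfolding \<U>_def by auto
    then show ?thesis
    proof cases
      case conj
      then show ?thesis by (simp add: openin_groups_conjugating dense_groups_conjugating)
    next
      case law
      then obtain n where "w \<in> words {1..n}" "w \<noteq> []" "freely_reduced w"
        by (auto simp: nontrivial_words_def)
      then show ?thesis
        using dense_groups_violating by (simp add: law(1) openin_groups_violating)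
    qed
  qed
  ultimately have "comeager_in (enumerated_space P) \<X>"
    unfolding comeager_in_def top by (intro conjI exI[of _ \<U>]) (auto simp: \<X>_def)
  moreover have "one_nontrivial_conjugacy_class (group_of c) \<and>
       is_simple (group_of c) \<and> verbally_complete (group_of c)" if c: "c \<in> \<X>" for c
  proof -
    have cP: "c \<in> groups_with P" using c by (simp add: \<X>_def)
    interpret c: group "group_of c" using cP by (rule groups_withD)
    have conj: "\<exists>h \<in> carrier (group_of c).
        h \<otimes>\<^bsub>group_of c\<^esub> f \<otimes>\<^bsub>group_of c\<^esub> inv\<^bsub>group_of c\<^esub> h = g"
      if "f \<in> carrier (group_of c) - {\<one>\<^bsub>group_of c\<^esub>}"
        "g \<in> carrier (group_of c) - {\<one>\<^bsub>group_of c\<^esub>}" for f g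
    proof -
      have "groups_conjugating P f g \<in> \<U>" unfolding \<U>_def by force
      then have "c \<in> groups_conjugating P f g" using c by (auto simp: \<X>_def)
      then show ?thesis using that by (auto simp: groups_conjugating_def)
    qed
    have "no_law (group_of c)"
      unfolding no_law_def
    proof (intro allI ballI impI)
      fix n :: nat and w assume "w \<in> words {1..n}" "w \<noteq> [] \<and> freely_reduced w"
      then have "groups_violating P w \<in> \<U>" by (auto simp: \<U>_def nontrivial_words_def)
      then have "c \<in> groups_violating P w" using c by (auto simp: \<X>_def)
      then show "\<exists>a \<in> {1..n} \<rightarrow> carrier (group_of c). word_eval (group_of c) a w \<noteq> \<one>\<^bsub>group_of c\<^esub>"
        by (auto simp: groups_violating_def)
    qed
    moreover have "carrier (group_of c) \<noteq> {\<one>\<^bsub>group_of c\<^esub>}"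
      using infinite_UNIV_nat by (metis finite.emptyI finite_insert group_of_simps(1))
    ultimately show ?thesis
      using c.one_nontrivial_conjugacy_classI[OF conj] c.is_simpleI[OF conj]
        c.verbally_completeI[OF conj] by blast
  qed
  ultimately show ?thesis by blast
qed

end
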